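(* Let $C>1$, $Q=(0,1)$ and $x\in\Omega_C$. With the candidates $b_{p,C},B_{2,C},A_{\delta,C},D_{\lambda,C}$, the functions $\varphi_x^\pm,\psi_x,\eta_x$ on $Q$, and the notion of optimizer as defined in the context: (1) The function $\varphi_x^+$ is an optimizer for $b_{p,C}(x)$, $1<p\le2$, and for $A_{\delta,C}(x)$, $1\le\delta<1/\xi^+$. (2) The function $\varphi_x^-$ is an optimizer for $B_{2,C}(x)$. (3) The function $\psi_x$ is an optimizer for $b_{1,C}(x)$. (4) For any $\lambda\in\mathbb R$, the function $\eta_x$ is an optimizer for $D_{\lambda,C}(x)$.
   Context: **Basic notation.** $Q=(0,1)$. For an interval $J$, $\langle\varphi\rangle_J=\frac1{|J|}\int_J\varphi$. For an a.e. positive $w$ on $Q$ with $w,\log w$ locally integrable, $[w]_{A_\infty(Q)}=\sup_{J\subset Q}\langle w\rangle_Je^{-\langle\log w\rangle_J}$ (supremum over all subintervals $J$ of $Q$). For $C>1$, $\Omega_C=\{x\in\mathbb R^2:\ e^{x_1}\le x_2\le Ce^{x_1}\}$, and for $x\in\Omega_C$ $$E_{x,C,Q}=\{\varphi\in L^1(Q):\ \langle\varphi\rangle_Q=x_1,\ \langle e^\varphi\rangle_Q=x_2,\ [e^\varphi]_{A_\infty(Q)}\le C\}.$$ **Optimizers.** If $G$ is one of the candidates below and $x\in\Omega_C$, a function $\varphi$ on $Q$ is an optimizer for $G(x)$ if $\varphi\in E_{x,C,Q}$ and $\langle f(\varphi)\rangle_Q=G(x)$, where $f(t)=|t|^p$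 for $G=b_{p,C}$; $f(t)=t^2$ for $G=B_{2,C}$; $f(t)=e^{\delta t}$ for $G=A_{\delta,C}$; $f(t)=\chi_{[\lambda,\infty)}(t)$ for $G=D_{\lambda,C}$. **Auxiliary functions.** $\xi^\pm=\xi^\pm(C)$ are the two solutions of $e^{-\xi}=C(1-\xi)$ with $-\infty<\xi^-<0<\xi^+<1$. The functions $u^\pm=u^\pm(x)$ on $\Omega_C$ are defined implicitly by $$x_2=e^{u^\pm}\Big(\frac{x_1-u^\pm}{1-\xi^\pm}+1\Big),\qquad x_1-\xi^+\le u^+\le x_1,\qquad x_1\le u^-\le x_1-\xi^-.$$ **Candidates.** For $p\in(1,2]$: $$b_{p,C}(x)=\frac p{\xi^+}\,e^{u^+/\xi^+}\Big[\int_{u^+}^\infty|s|^{p-1}\operatorname{sgn}(s)\,e^{-s/\xi^+}ds\Big](x_1-u^+)+|u^+|^p.$$ $$B_{2,C}(x)=2u^-x_1-(u^-)^2+2\xi^-(x_1-u^-).$$ $b_{1,C}$: write $\Omega_C=\Omega_-\cup\Omega_0\cup\Omega_+$ with $\Omega_-=\{x_1\le\xi^-,\ e^{x_1}\le x_2\le Ce^{x_1}\}\cup\{\xi^-\le x_1\le0,\ e^{x_1}\le x_2\le Ce^{\xi^-}x_1+1\}$, $\Omega_0=\{\xi^-\le x_1\le0,\ Ce^{\xi^-}x_1+1\le x_2\le Ce^{x_1}\}\cup\{0\le x_1\le\xi^+,\ Ce^{\xi^+}x_1+1\le x_2\le Ce^{x_1}\}$, $\Omega_+=\{0\le x_1\le\xi^+,\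 e^{x_1}\le x_2\le Ce^{\xi^+}x_1+1\}\cup\{x_1\ge\xi^+,\ e^{x_1}\le x_2\le Ce^{x_1}\}$. Then $b_{1,C}(x)=-x_1$ on $\Omega_-$, $b_{1,C}(x)=x_1$ on $\Omega_+$, and on $\Omega_0$ $$b_{1,C}(x)=2\,\frac{(1-\xi^-)(1-\xi^+)}{\xi^+-\xi^-}\,(x_2-1)+\frac{\xi^++\xi^--2}{\xi^+-\xi^-}\,x_1.$$ For $1\le\delta<1/\xi^+$: $$A_{\delta,C}(x)=e^{\delta u^+}\Big(\frac{\delta}{1-\delta\xi^+}(x_1-u^+)+1\Big).$$ $D_{\lambda,C}$: write $\Omega_C=\bigcup_{k=1}^4\Omega_k(\lambda)$ with $\Omega_1(\lambda)=\{x_1\le\lambda+\xi^--\xi^+,\ e^{x_1}\le x_2\le Ce^{x_1}\}\cup\{\lambda+\xi^--\xi^+\le x_1\le\lambda+\xi^-,\ e^\lambda(Ce^{\xi^-}(x_1-\lambda)+1)\le x_2\le Ce^{x_1}\}$, $\Omega_2(\lambda)=\{\lambda+\xi^--\xi^+\le x_1<\lambda,\ e^{x_1}\le x_2\le e^\lambda(Ce^{\xi^-}(x_1-\lambda)+1)\}$, $\Omega_3(\lambda)=\{\lambda+\xi^-\le x_1\le\lambda,\ e^\lambda(Ce^{\xi^-}(x_1-\lambda)+1)\le x_2\le Ce^{x_1}\}\cup\{\lambda\le x_1\le\lambda+\xi^+,\ e^\lambda(Ce^{\xi^+}(x_1-\lambda)+1)\le x_2\le Ce^{x_1}\}$, $\Omega_4(\lambda)=\{\lambda\le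 x_1\le\lambda+\xi^+,\ e^{x_1}\le x_2\le e^\lambda(Ce^{\xi^+}(x_1-\lambda)+1)\}\cup\{x_1\ge\lambda+\xi^+,\ e^{x_1}\le x_2\le Ce^{x_1}\}$. For $x\in\Omega_2(\lambda)$ let $v=v(x)<\lambda$ be the horizontal coordinate of the second point where the line through $(\lambda,e^\lambda)$ and $x$ meets the curve $x_2=e^{x_1}$, i.e. $\frac{e^v-e^\lambda}{v-\lambda}=\frac{x_2-e^\lambda}{x_1-\lambda}$. Then $$D_{\lambda,C}(x)=\begin{cases}1,&x\in\Omega_4(\lambda),\\ \frac{1-\xi^-}{(\xi^+-\xi^-)^2}\big[x_1-\lambda+(1-x_2e^{-\lambda})(1-\xi^+)\big]+1,&x\in\Omega_3(\lambda),\\ \frac{x_1-v}{\lambda-v},&x\in\Omega_2(\lambda),\\ \frac{1}{\xi^+-\xi^-}\,e^{(\xi^+-\xi^-+u^+-\lambda)/\xi^+}\,(x_1-u^+),&x\in\Omega_1(\lambda).\end{cases}$$ **The functions $\varphi_x^\pm,\psi_x,\eta_x$ on $Q=(0,1)$** (defined up to null sets; definitions agree a.e. where subdomains overlap). For $x\in\Omega_C$, $$\varphi^\pm_x(t)=u^\pm+\xi^\pm\log\big(\tfrac{\alpha^\pm}t\big)\chi_{(0,\alpha^\pm)}(t),\qquad\alpha^\pm=\frac{x_1-u^\pm}{\xi^\pm}$$ (the second term is $0$ if $\alpha^\pm=0$). $\psi_x$: for $x\in\Omega_+$, $\psi_x=u^++(\xi^+-\xi^-)\chi_{(0,\beta^+)}$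 with $\beta^+=\frac{x_1-u^+}{\xi^+-\xi^-}$; for $x\in\Omega_-$, $\psi_x=u^--(\xi^+-\xi^-)\chi_{(1-\beta^-,1)}$ with $\beta^-=\frac{u^--x_1}{\xi^+-\xi^-}$; for $x\in\Omega_0$, $\psi_x=(\xi^+-\xi^-)\big(\chi_{(0,\gamma^+)}-\chi_{(1-\gamma^-,1)}\big)$ with $$\gamma^\pm=\frac{(x_2-1)(1-\xi^-)(1-\xi^+)-x_1(1-\xi^\pm)}{(\xi^+-\xi^-)^2}.$$ $\eta_x$ (depending on $\lambda$): for $x\in\Omega_3(\lambda)\cup\Omega_4(\lambda)$, $\eta_x=\lambda+\psi_{(x_1-\lambda,\,x_2e^{-\lambda})}$ (the point $(x_1-\lambda,x_2e^{-\lambda})$ lies in $\Omega_0$ if $x\in\Omega_3(\lambda)$ and in $\Omega_+$ if $x\in\Omega_4(\lambda)$); for $x\in\Omega_2(\lambda)$, $\eta_x=\lambda\chi_{(0,\mu)}+v\chi_{(\mu,1)}$ with $\mu=\frac{x_1-v}{\lambda-v}$; for $x\in\Omega_1(\lambda)$, $$\eta_x=\lambda\chi_{(0,\tau\beta^+)}+(\lambda+\xi^--\xi^+)\chi_{(\tau\beta^+,\tau\alpha^+)}+\varphi_x^+\chi_{(\tau\alpha^+,1)},\quad\tau=e^{(u^++\xi^+-\xi^--\lambda)/\xi^+},\ \beta^+=\frac{x_1-u^+}{\xi^+-\xi^-},\ \alpha^+=\frac{x_1-u^+}{\xi^+}.$$ *)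

theory Defs
  imports "HOL-Analysis.Analysis"
begin

section \<open>Averages, the \<open>A\<^sub>\<infinity>\<close> characteristic and the admissible classes\<close>

abbreviation Q :: "real set" where
  "Q \<equiv> {0<..<1}"

definition avg :: "real set \<Rightarrow> (real \<Rightarrow> real) \<Rightarrow> real" where
  "avg J g = (LINT t:J|lebesgue. g t) / measure lebesgue J"

text \<open>
  The averages are Bochner integrals, so the supremum is meaningful only if \<open>w\<close> and \<open>ln w\<close> are
  integrable on the subintervals of \<open>I\<close>; the class \<open>E_class\<close> below guarantees this.
\<close>

definition A_infty_char :: "real set \<Rightarrow> (real \<Rightarrow> real) \<Rightarrow> ereal" where
  "A_infty_char I w =
     (SUP J \<in> {J. is_interval J \<and> J \<subseteq> I \<and> measure lebesgue J > 0}.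
        ereal (avg J w * exp (- avg J (\<lambda>t. ln (w t)))))"

definition Omega :: "real \<Rightarrow> (real \<times> real) set" where
  "Omega C = {(x1, x2). exp x1 \<le> x2 \<and> x2 \<le> C * exp x1}"

definition E_class :: "real \<times> real \<Rightarrow> real \<Rightarrow> real set \<Rightarrow> (real \<Rightarrow> real) set" where
  "E_class x C I =
     {\<phi>. \<phi> absolutely_integrable_on I \<and>
         (\<lambda>t. exp (\<phi> t)) absolutely_integrable_on I \<and>
         avg I \<phi> = fst x \<and>
         avg I (\<lambda>t. exp (\<phi> t)) = snd x \<and>
         A_infty_char I (\<lambda>t. exp (\<phi> t)) \<le> ereal C}"

text \<open>
  Integrability of \<open>f \<circ> \<phi>\<close> is demanded explicitly, since the Bochner integral of a
  non-integrable function is \<open>0\<close>.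
\<close>

definition is_optimizer ::
  "(real \<Rightarrow> real) \<Rightarrow> (real \<times> real \<Rightarrow> real) \<Rightarrow> real \<Rightarrow> real \<times> real \<Rightarrow> (real \<Rightarrow> real) \<Rightarrow> bool" where
  "is_optimizer f G C x \<phi> \<longleftrightarrow>
     \<phi> \<in> E_class x C Q \<and>
     (\<lambda>t. f (\<phi> t)) absolutely_integrable_on Q \<and>
     avg Q (\<lambda>t. f (\<phi> t)) = G x"


section \<open>Auxiliary functions\<close>

definition xi_plus :: "real \<Rightarrow> real" where
  "xi_plus C = (THE \<xi>. exp (- \<xi>) = C * (1 - \<xi>) \<and> 0 < \<xi> \<and> \<xi> < 1)"

definition xi_minus :: "real \<Rightarrow> real" where
  "xi_minus C = (THE \<xi>. exp (- \<xi>) = C * (1 - \<xi>) \<and> \<xi> < 0)"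

definition u_plus :: "real \<Rightarrow> real \<times> real \<Rightarrow> real" where
  "u_plus C = (\<lambda>(x1, x2). THE u.
     x2 = exp u * ((x1 - u) / (1 - xi_plus C) + 1) \<and> x1 - xi_plus C \<le> u \<and> u \<le> x1)"

definition u_minus :: "real \<Rightarrow> real \<times> real \<Rightarrow> real" where
  "u_minus C = (\<lambda>(x1, x2). THE u.
     x2 = exp u * ((x1 - u) / (1 - xi_minus C) + 1) \<and> x1 \<le> u \<and> u \<le> x1 - xi_minus C)"


section \<open>Candidates\<close>

text \<open>
  \<open>b_cand p\<close> is the candidate for \<open>1 < p \<le> 2\<close>; the case \<open>p = 1\<close> is \<open>b1_cand\<close>.
\<close>

definition b_cand :: "real \<Rightarrow> real \<Rightarrow> real \<times> real \<Rightarrow> real" where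
  "b_cand p C x =
     (let \<xi> = xi_plus C; u = u_plus C x in
        p / \<xi> * exp (u / \<xi>)
          * (LINT s:{u<..}|lebesgue. \<bar>s\<bar> powr (p - 1) * sgn s * exp (- s / \<xi>))
          * (fst x - u)
        + \<bar>u\<bar> powr p)"

definition B2_cand :: "real \<Rightarrow> real \<times> real \<Rightarrow> real" where
  "B2_cand C x =
     (let \<xi> = xi_minus C; u = u_minus C x in
        2 * u * fst x - u\<^sup>2 + 2 * \<xi> * (fst x - u))"

definition Omega_minus :: "real \<Rightarrow> (real \<times> real) set" where
  "Omega_minus C =
     {(x1, x2). x1 \<le> xi_minus C \<and> exp x1 \<le> x2 \<and> x2 \<le> C * exp x1} \<union>
     {(x1, x2). xi_minus C \<le> x1 \<and> x1 \<le> 0 \<and>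
        exp x1 \<le> x2 \<and> x2 \<le> C * exp (xi_minus C) * x1 + 1}"

definition Omega_zero :: "real \<Rightarrow> (real \<times> real) set" where
  "Omega_zero C =
     {(x1, x2). xi_minus C \<le> x1 \<and> x1 \<le> 0 \<and>
        C * exp (xi_minus C) * x1 + 1 \<le> x2 \<and> x2 \<le> C * exp x1} \<union>
     {(x1, x2). 0 \<le> x1 \<and> x1 \<le> xi_plus C \<and>
        C * exp (xi_plus C) * x1 + 1 \<le> x2 \<and> x2 \<le> C * exp x1}"

definition Omega_plus :: "real \<Rightarrow> (real \<times> real) set" where
  "Omega_plus C =
     {(x1, x2). 0 \<le> x1 \<and> x1 \<le> xi_plus C \<and>
        exp x1 \<le> x2 \<and> x2 \<le> C * exp (xi_plus C) * x1 + 1} \<union>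
     {(x1, x2). xi_plus C \<le> x1 \<and> exp x1 \<le> x2 \<and> x2 \<le> C * exp x1}"

text \<open>
  Here and below, the branches of a piecewise definition agree (almost everywhere, for functions
  on \<open>Q\<close>) where the subdomains overlap, so the order of the case distinctions is immaterial.
  The last branch covers the remaining part of \<open>Omega C\<close>, namely \<open>Omega_zero C\<close> for
  \<open>b1_cand\<close> and \<open>psi\<close>, and \<open>Omega1 C lam\<close> for \<open>D_cand\<close> and \<open>eta\<close>.
\<close>

definition b1_cand :: "real \<Rightarrow> real \<times> real \<Rightarrow> real" where
  "b1_cand C x =
     (let \<xi>p = xi_plus C; \<xi>m = xi_minus C in
        if x \<in> Omega_minus C then - fst x
        else if x \<in> Omega_plus C then fst x
        else 2 * ((1 - \<xi>m) * (1 - \<xi>p) / (\<xi>p - \<xi>m)) * (snd x - 1)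
             + (\<xi>p + \<xi>m - 2) / (\<xi>p - \<xi>m) * fst x)"

definition A_cand :: "real \<Rightarrow> real \<Rightarrow> real \<times> real \<Rightarrow> real" where
  "A_cand \<delta> C x =
     (let \<xi> = xi_plus C; u = u_plus C x in
        exp (\<delta> * u) * (\<delta> / (1 - \<delta> * \<xi>) * (fst x - u) + 1))"

definition Omega1 :: "real \<Rightarrow> real \<Rightarrow> (real \<times> real) set" where
  "Omega1 C lam =
     {(x1, x2). x1 \<le> lam + xi_minus C - xi_plus C \<and> exp x1 \<le> x2 \<and> x2 \<le> C * exp x1} \<union>
     {(x1, x2). lam + xi_minus C - xi_plus C \<le> x1 \<and> x1 \<le> lam + xi_minus C \<and>
        exp lam * (C * exp (xi_minus C) * (x1 - lam) + 1) \<le> x2 \<and> x2 \<le> C * exp x1}"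

definition Omega2 :: "real \<Rightarrow> real \<Rightarrow> (real \<times> real) set" where
  "Omega2 C lam =
     {(x1, x2). lam + xi_minus C - xi_plus C \<le> x1 \<and> x1 < lam \<and>
        exp x1 \<le> x2 \<and> x2 \<le> exp lam * (C * exp (xi_minus C) * (x1 - lam) + 1)}"

definition Omega3 :: "real \<Rightarrow> real \<Rightarrow> (real \<times> real) set" where
  "Omega3 C lam =
     {(x1, x2). lam + xi_minus C \<le> x1 \<and> x1 \<le> lam \<and>
        exp lam * (C * exp (xi_minus C) * (x1 - lam) + 1) \<le> x2 \<and> x2 \<le> C * exp x1} \<union>
     {(x1, x2). lam \<le> x1 \<and> x1 \<le> lam + xi_plus C \<and>
        exp lam * (C * exp (xi_plus C) * (x1 - lam) + 1) \<le> x2 \<and> x2 \<le> C * exp x1}"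

definition Omega4 :: "real \<Rightarrow> real \<Rightarrow> (real \<times> real) set" where
  "Omega4 C lam =
     {(x1, x2). lam \<le> x1 \<and> x1 \<le> lam + xi_plus C \<and>
        exp x1 \<le> x2 \<and> x2 \<le> exp lam * (C * exp (xi_plus C) * (x1 - lam) + 1)} \<union>
     {(x1, x2). lam + xi_plus C \<le> x1 \<and> exp x1 \<le> x2 \<and> x2 \<le> C * exp x1}"

definition v_coord :: "real \<Rightarrow> real \<times> real \<Rightarrow> real" where
  "v_coord lam = (\<lambda>(x1, x2). THE v.
     v < lam \<and> (exp v - exp lam) / (v - lam) = (x2 - exp lam) / (x1 - lam))"

definition D_cand :: "real \<Rightarrow> real \<Rightarrow> real \<times> real \<Rightarrow> real" where
  "D_cand lam C x =
     (let \<xi>p = xi_plus C; \<xi>m = xi_minus C; u = u_plus C x; v = v_coord lam x in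
        if x \<in> Omega4 C lam then 1
        else if x \<in> Omega3 C lam then
          (1 - \<xi>m) / (\<xi>p - \<xi>m)\<^sup>2 * (fst x - lam + (1 - snd x * exp (- lam)) * (1 - \<xi>p)) + 1
        else if x \<in> Omega2 C lam then (fst x - v) / (lam - v)
        else 1 / (\<xi>p - \<xi>m) * exp ((\<xi>p - \<xi>m + u - lam) / \<xi>p) * (fst x - u))"


section \<open>The functions \<open>\<phi>\<^sup>\<plusminus>\<close>, \<open>\<psi>\<close> and \<open>\<eta>\<close>\<close>

definition phi_plus :: "real \<Rightarrow> real \<times> real \<Rightarrow> real \<Rightarrow> real" where
  "phi_plus C x t =
     (let \<xi> = xi_plus C; u = u_plus C x; \<alpha> = (fst x - u) / \<xi> in
        u + \<xi> * ln (\<alpha> / t) * indicat_real {0<..<\<alpha>} t)"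

definition phi_minus :: "real \<Rightarrow> real \<times> real \<Rightarrow> real \<Rightarrow> real" where
  "phi_minus C x t =
     (let \<xi> = xi_minus C; u = u_minus C x; \<alpha> = (fst x - u) / \<xi> in
        u + \<xi> * ln (\<alpha> / t) * indicat_real {0<..<\<alpha>} t)"

definition psi :: "real \<Rightarrow> real \<times> real \<Rightarrow> real \<Rightarrow> real" where
  "psi C x t =
     (let \<xi>p = xi_plus C; \<xi>m = xi_minus C; up = u_plus C x; um = u_minus C x;
          \<beta>p = (fst x - up) / (\<xi>p - \<xi>m);
          \<beta>m = (um - fst x) / (\<xi>p - \<xi>m);
          \<gamma>p = ((snd x - 1) * (1 - \<xi>m) * (1 - \<xi>p) - fst x * (1 - \<xi>p)) / (\<xi>p - \<xi>m)\<^sup>2;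
          \<gamma>m = ((snd x - 1) * (1 - \<xi>m) * (1 - \<xi>p) - fst x * (1 - \<xi>m)) / (\<xi>p - \<xi>m)\<^sup>2
      in
        if x \<in> Omega_plus C then up + (\<xi>p - \<xi>m) * indicat_real {0<..<\<beta>p} t
        else if x \<in> Omega_minus C then um - (\<xi>p - \<xi>m) * indicat_real {1 - \<beta>m<..<1} t
        else (\<xi>p - \<xi>m) * (indicat_real {0<..<\<gamma>p} t - indicat_real {1 - \<gamma>m<..<1} t))"

definition eta :: "real \<Rightarrow> real \<Rightarrow> real \<times> real \<Rightarrow> real \<Rightarrow> real" where
  "eta lam C x t =
     (let \<xi>p = xi_plus C; \<xi>m = xi_minus C; u = u_plus C x; v = v_coord lam x;
          \<mu> = (fst x - v) / (lam - v);
          \<tau> = exp ((u + \<xi>p - \<xi>m - lam) / \<xi>p);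
          \<beta> = (fst x - u) / (\<xi>p - \<xi>m);
          \<alpha> = (fst x - u) / \<xi>p
      in
        if x \<in> Omega3 C lam \<union> Omega4 C lam then
          lam + psi C (fst x - lam, snd x * exp (- lam)) t
        else if x \<in> Omega2 C lam then
          lam * indicat_real {0<..<\<mu>} t + v * indicat_real {\<mu><..<1} t
        else
          lam * indicat_real {0<..<\<tau> * \<beta>} t
          + (lam + \<xi>m - \<xi>p) * indicat_real {\<tau> * \<beta><..<\<tau> * \<alpha>} t
          + phi_plus C x t * indicat_real {\<tau> * \<alpha><..<1} t)"

end

theory Submission
  imports Defs "HOL-Real_Asymp.Real_Asymp"
begin

text \<open>
  The averages are explicit integrals; the point is the bound \<open>\<langle>exp \<phi>\<rangle> \<le> C exp \<langle>\<phi>\<rangle>\<close> on every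
  subinterval \<open>J\<close>. Since the upper boundary of \<open>Omega C\<close> is a convex curve, it suffices to find one
  tangent to it, with tangency point \<open>a\<close>, above the point of averages, i.e. to show that the convex function
  \<open>g y = exp y - C * exp a * (1 - a + y)\<close> satisfies \<open>\<integral>\<^sub>J g \<circ> \<phi> \<le> 0\<close>. Its zeros are
  \<open>a - xi_plus C\<close> and \<open>a - xi_minus C\<close>, so any \<open>\<phi>\<close> whose range has length at most
  \<open>xi_plus C - xi_minus C\<close> is admissible; this settles the two-valued functions. For a logarithm, take the
  tangent with a zero of \<open>g\<close> at the value of \<open>\<phi>\<close> at the right endpoint \<open>r\<close> of \<open>J\<close>: then
  \<open>\<integral>\<^sub>0\<^sup>r g \<circ> \<phi> = 0\<close>, and monotonicity of \<open>\<phi>\<close> lets \<open>g \<circ> \<phi>\<close> be positive only on an initial segment.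
\<close>

section \<open>Tangents to the upper boundary\<close>

text \<open>Write d for \<open>xi_plus C - xi_minus C\<close>. It is the width of a chord of the
  lower boundary that touches the upper one, so the averages of a function with two values at
  distance d run along a tangent; the weights in \<open>psi\<close> and \<open>eta\<close> come from
  this. Two functions fit neither mechanism as it stands. On \<open>Omega_zero C\<close> the values
  of \<open>psi\<close> are d, 0 and -d, with spread 2d, and an interval that meets all three needs
  a different tangent, the one at the abscissa of the prescribed point. On
  \<open>Omega1 C lam\<close> two steps of height d apart are followed by a logarithm; that function
  is compared with the pure logarithm \<open>phi_plus\<close>. The comparison is possible because a
  gap integral sees a function only through its integral and the integral of its exponential. The
  integrals are computed as gauge integrals over closed intervals, where the fundamental theorem
  tolerates the singularity of the logarithm at 0, and are turned into the Lebesgue averages of the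
  definitions by means of absolute integrability.\<close>

definition tangent_gap :: "real \<Rightarrow> real \<Rightarrow> real \<Rightarrow> real" where
  "tangent_gap C a y = exp y - C * exp a * (1 - a + y)"

lemma convex_on_tangent_gap: "convex_on UNIV (tangent_gap C a)"
proof (rule convex_onI)
  fix t x y :: real
  assume t: "0 < t" "t < 1"
  have "exp ((1 - t) *\<^sub>R x + t *\<^sub>R y) \<le> (1 - t) * exp x + t * exp y"
    using convex_onD[OF exp_convex, of t x y] t by auto
  then show "tangent_gap C a ((1 - t) *\<^sub>R x + t *\<^sub>R y)
      \<le> (1 - t) * tangent_gap C a x + t * tangent_gap C a y"
    unfolding tangent_gap_def by (simp add: algebra_simps)
qed auto

lemma tangent_gap_le_0_between:
  assumes "tangent_gap C a y \<le> 0" "tangent_gap C a z \<le> 0" "y \<le> w" "w \<le> z"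
  shows "tangent_gap C a w \<le> 0"
proof -
  have "w \<in> closed_segment y z" using assms by (auto simp: closed_segment_eq_real_ivl)
  then obtain t where t: "0 \<le> t" "t \<le> 1" "w = (1 - t) *\<^sub>R y + t *\<^sub>R z"
    by (auto simp: in_segment)
  have "tangent_gap C a w \<le> (1 - t) * tangent_gap C a y + t * tangent_gap C a z"
    using convex_onD[OF convex_on_tangent_gap[of C a], of t y z] t by auto
  also have "\<dots> \<le> 0" using t assms by (intro add_nonpos_nonpos mult_nonneg_nonpos) auto
  finally show ?thesis .
qed

lemma tangent_gap_contact:
  assumes "exp (- \<xi>) = C * (1 - \<xi>)"
  shows "tangent_gap C (y + \<xi>) y = 0"
proof -
  have "C * exp (y + \<xi>) * (1 - \<xi>) = exp (y + \<xi>) * exp (- \<xi>)" using assms by simp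
  then show ?thesis by (simp add: tangent_gap_def flip: exp_add)
qed

text \<open>The gap is affine in the pair (\<phi>, exp \<phi>), so on each interval only two numbers
  matter. Functions with equal integrals and equal exponential integrals therefore have equal gap
  integrals for every tangent.\<close>

lemma tangent_gap_has_integral:
  fixes \<phi> :: "real \<Rightarrow> real"
  assumes "(\<phi> has_integral I) {s..r}" "((\<lambda>t. exp (\<phi> t)) has_integral K) {s..r}" "s \<le> r"
  shows "((\<lambda>t. tangent_gap C a (\<phi> t)) has_integral (K - C * exp a * ((1 - a) * (r - s) + I))) {s..r}"
proof -
  have "((\<lambda>t. 1 - a + \<phi> t) has_integral ((1 - a) * (r - s) + I)) {s..r}"
    using has_integral_add[OF has_integral_const_real[of "1 - a" s r] assms(1)] assms(3)
    by (simp add: algebra_simps)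
  from has_integral_diff[OF assms(2) has_integral_mult_right[OF this, of "C * exp a"]]
  show ?thesis unfolding tangent_gap_def .
qed

section \<open>From arbitrary subintervals of \<open>Q\<close> to closed intervals\<close>

lemma bounded_interval_spike:
  fixes J :: "real set"
  assumes "is_interval J" "J \<subseteq> {a<..<b}" "measure lebesgue J > 0"
  obtains s r where "a \<le> s" "s < r" "r \<le> b" "{s<..<r} \<subseteq> J" "J \<subseteq> {s..r}"
proof -
  have ne: "J \<noteq> {}" using assms(3) by auto
  have bb: "bdd_below J" "bdd_above J" using assms(2)
    by (auto intro!: bdd_belowI[of _ a] bdd_aboveI[of _ b] simp: subset_iff less_imp_le)
  define s r where "s = Inf J" and "r = Sup J"
  have 1: "J \<subseteq> {s..r}" unfolding s_def r_def using bb by (auto intro: cInf_lower cSup_upper)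
  have 2: "{s<..<r} \<subseteq> J"
  proof
    fix t assume t: "t \<in> {s<..<r}"
    then obtain y where y: "y \<in> J" "y < t"
      using cInf_lessD[OF ne, of t] unfolding s_def by auto
    from t obtain z where z: "z \<in> J" "t < z"
      using less_cSupD[OF ne, of t] unfolding r_def by auto
    show "t \<in> J" using assms(1) y z unfolding is_interval_1 by (meson less_imp_le)
  qed
  have 3: "a \<le> s" unfolding s_def using ne assms(2)
    by (intro cInf_greatest) (auto simp: subset_iff less_imp_le)
  have 4: "r \<le> b" unfolding r_def using ne assms(2)
    by (intro cSup_least) (auto simp: subset_iff less_imp_le)
  have "s < r"
  proof (rule ccontr)
    assume "\<not> s < r"
    then have "J \<subseteq> {s}" using 1 by auto
    then have "measure lebesgue J = 0"
      by (meson negligible_imp_measure0 negligible_sing negligible_subset)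
    then show False using assms(3) by simp
  qed
  with 1 2 3 4 that show ?thesis by blast
qed

text \<open>\<open>has_integral\<close> alone is a statement about the gauge integral and does not
  determine the Bochner integral behind \<open>avg\<close>; absolute integrability makes the two
  agree.\<close>

lemma avg_Q:
  assumes "(g has_integral I) {0..1}" "g absolutely_integrable_on {0..1}"
  shows "g absolutely_integrable_on Q" "avg Q g = I"
proof -
  show 1: "g absolutely_integrable_on Q"
    using assms(2) by (rule set_integrable_subset) auto
  have "(LINT t:Q|lebesgue. g t) = integral Q g"
    by (rule set_lebesgue_integral_eq_integral(2)[OF 1])
  also have "\<dots> = I" using assms(1)
    by (metis integral_open_interval_real integral_unique)
  finally show "avg Q g = I" by (simp add: avg_def)
qed

text \<open>With A the mean of \<phi> over the interval, a nonpositive gap integral puts the mean of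
  exp \<phi> below C * exp a * (1 - a + A), and 1 - a + A \<le> exp (A - a) removes a. The tangent
  may thus be chosen anew for every interval.\<close>

lemma A_infty_char_le:
  fixes \<phi> :: "real \<Rightarrow> real"
  assumes phi: "\<phi> absolutely_integrable_on {0..1}"
    and ephi: "(\<lambda>t. exp (\<phi> t)) absolutely_integrable_on {0..1}"
    and C: "C > 0"
    and gap: "\<And>s r. \<lbrakk>0 \<le> s; s < r; r \<le> 1\<rbrakk> \<Longrightarrow>
      \<exists>a. integral {s..r} (\<lambda>t. tangent_gap C a (\<phi> t)) \<le> 0"
  shows "A_infty_char Q (\<lambda>t. exp (\<phi> t)) \<le> ereal C"
  unfolding A_infty_char_def
proof (rule SUP_least)
  fix J :: "real set"
  assume "J \<in> {J. is_interval J \<and> J \<subseteq> Q \<and> measure lebesgue J > 0}"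
  then have J: "is_interval J" "J \<subseteq> Q" "measure lebesgue J > 0" by auto
  obtain s r where
    sr: "0 \<le> s" "s < r" "r \<le> 1" "{s<..<r} \<subseteq> J" "J \<subseteq> {s..r}"
    by (rule bounded_interval_spike[OF J])
  define L where "L = measure lebesgue J"
  have "t = s \<or> t = r" if "t \<in> {s..r} - J" for t
    using that subsetD[OF sr(4), of t] by force
  then have "{s..r} - J \<subseteq> {s, r}" by blast
  moreover have "J - {s..r} = {}" using sr(5) by blast
  ultimately have N: "negligible (J - {s..r})" "negligible ({s..r} - J)"
    using negligible_subset[of "{s, r}"] by auto
  have Jm: "J \<in> lmeasurable"
    using J(1) sr(5) by (intro measurable_convex is_interval_convex) (auto intro: bounded_subset[OF bounded_closed_interval])
  have int: "integral {s..r} g = (LINT t:J|lebesgue. g t)" if "g absolutely_integrable_on {0..1}" for g :: "real \<Rightarrow> real"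
  proof -
    have "g absolutely_integrable_on J"
      by (rule set_integrable_subset[OF that]) (use sr Jm in auto)
    then have "(LINT t:J|lebesgue. g t) = integral J g"
      by (rule set_lebesgue_integral_eq_integral(2))
    also have "\<dots> = integral {s..r} g"
      by (rule integral_spike_set) (rule negligible_subset[OF N(1)] negligible_subset[OF N(2)], blast)+
    finally show ?thesis by simp
  qed
  obtain a where a: "integral {s..r} (\<lambda>t. tangent_gap C a (\<phi> t)) \<le> 0"
    using gap sr by blast
  have L: "L = r - s"
  proof -
    have "L = measure lebesgue {s..r}" unfolding L_def
      by (rule measure_negligible_symdiff[symmetric])
         (use Jm N in \<open>auto simp: negligible_Un\<close>)
    then show ?thesis using sr by simp
  qed
  define P E where "P = integral {s..r} \<phi>" and "E = integral {s..r} (\<lambda>t. exp (\<phi> t))"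
  have sub: "g integrable_on {s..r}" if "g absolutely_integrable_on {0..1}" for g :: "real \<Rightarrow> real"
    using that sr by (meson atLeastatMost_subset_iff integrable_on_subinterval set_lebesgue_integral_eq_integral(1))
  have "((\<lambda>t. tangent_gap C a (\<phi> t)) has_integral (E - C * exp a * ((1 - a) * (r - s) + P))) {s..r}"
    unfolding P_def E_def
    by (rule tangent_gap_has_integral) (use sr sub phi ephi in \<open>auto intro: integrable_integral\<close>)
  with a have *: "E \<le> C * exp a * ((1 - a) * L + P)"
    by (simp add: L integral_unique)
  have Lp: "L > 0" using J L_def by simp
  define A where "A = P / L"
  have "E / L \<le> C * exp a * (1 - a + A)"
    using * Lp by (simp add: A_def field_simps)
  also have "\<dots> \<le> C * exp a * exp (A - a)"
  proof (rule mult_left_mono)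
    show "1 - a + A \<le> exp (A - a)" using exp_ge_add_one_self[of "A - a"] by linarith
  qed (use C in simp)
  also have "\<dots> = C * exp A" by (simp flip: exp_add)
  finally have "E / L * exp (- A) \<le> C * exp A * exp (- A)" by (rule mult_right_mono) simp
  also have "C * exp A * exp (- A) = C" by (simp add: exp_minus)
  finally have "E / L * exp (- A) \<le> C" .
  moreover have "avg J (\<lambda>t. exp (\<phi> t)) = E / L" "avg J (\<lambda>t. ln (exp (\<phi> t))) = A"
    unfolding avg_def A_def E_def P_def L_def using int[OF phi] int[OF ephi] by auto
  ultimately show "ereal (avg J (\<lambda>t. exp (\<phi> t)) * exp (- avg J (\<lambda>t. ln (exp (\<phi> t))))) \<le> ereal C"
    by simp
qed

text \<open>The exceptional set \<open>N\<close> absorbs the values at the endpoints of the open intervals in the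
  definitions, so that \<open>\<phi>\<close> may be chosen monotone.\<close>

lemma is_optimizerI:
  assumes N: "negligible N" "\<And>t. t \<in> {0..1} - N \<Longrightarrow> \<psi> t = \<phi> t"
    and C: "C > 0"
    and phi: "\<phi> absolutely_integrable_on {0..1}" "(\<phi> has_integral fst x) {0..1}"
    and ephi: "((\<lambda>t. exp (\<phi> t)) has_integral snd x) {0..1}"
    and f: "(\<lambda>t. f (\<phi> t)) absolutely_integrable_on {0..1}" "((\<lambda>t. f (\<phi> t)) has_integral G x) {0..1}"
    and gap: "\<And>s r. \<lbrakk>0 \<le> s; s < r; r \<le> 1\<rbrakk> \<Longrightarrow>
      \<exists>a. integral {s..r} (\<lambda>t. tangent_gap C a (\<phi> t)) \<le> 0"
  shows "is_optimizer f G C x \<psi>"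
proof -
  have ephi': "(\<lambda>t. exp (\<phi> t)) absolutely_integrable_on {0..1}"
    using ephi by (intro nonnegative_absolutely_integrable_1) auto
  have abs: "(\<lambda>t. F (\<psi> t)) absolutely_integrable_on {0..1}" 
    if "(\<lambda>t. F (\<phi> t)) absolutely_integrable_on {0..1}" for F :: "real \<Rightarrow> real"
    by (rule absolutely_integrable_spike[OF that N(1)]) (use N(2) in auto)
  have int: "((\<lambda>t. F (\<psi> t)) has_integral I) {0..1}" 
    if "((\<lambda>t. F (\<phi> t)) has_integral I) {0..1}" for F :: "real \<Rightarrow> real" and I
    by (rule has_integral_spike[OF N(1) _ that]) (use N(2) in auto)
  have gap': "\<exists>a. integral {s..r} (\<lambda>t. tangent_gap C a (\<psi> t)) \<le> 0" if "0 \<le> s" "s < r" "r \<le> 1" for s r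
  proof -
    from gap[OF that] obtain a where a: "integral {s..r} (\<lambda>t. tangent_gap C a (\<phi> t)) \<le> 0" by blast
    have "integral {s..r} (\<lambda>t. tangent_gap C a (\<psi> t)) = integral {s..r} (\<lambda>t. tangent_gap C a (\<phi> t))"
      by (rule integral_spike[OF N(1)]) (use N(2) that in auto)
    then have "integral {s..r} (\<lambda>t. tangent_gap C a (\<psi> t)) \<le> 0" using a by (simp only:)
    then show ?thesis ..
  qed
  have "A_infty_char Q (\<lambda>t. exp (\<psi> t)) \<le> ereal C"
    by (rule A_infty_char_le[OF abs[of "\<lambda>y. y", OF phi(1)] abs[OF ephi'] C gap'])
  then show ?thesis
    unfolding is_optimizer_def E_class_def
    using avg_Q[OF int[of "\<lambda>y. y", OF phi(2)] abs[of "\<lambda>y. y", OF phi(1)]] 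
      avg_Q[OF int[OF ephi] abs[OF ephi']] avg_Q[OF int[OF f(2)] abs[OF f(1)]]
    by simp
qed

section \<open>Two criteria for a nonpositive gap integral\<close>

lemma integral_Icc_nonpos:
  fixes g :: "real \<Rightarrow> real"
  assumes "g integrable_on {s..r}" "\<And>t. t \<in> {s<..<r} \<Longrightarrow> g t \<le> 0"
  shows "integral {s..r} g \<le> 0"
proof -
  have "(g has_integral integral {s..r} g) {s<..<r}"
    using integrable_integral[OF assms(1)] by (simp add: has_integral_Icc_iff_Ioo)
  from has_integral_le[OF this has_integral_0] show ?thesis using assms(2) by auto
qed

lemma gap_of_narrow_range:
  fixes \<phi> :: "real \<Rightarrow> real"
  assumes xp: "exp (- \<xi>p) = C * (1 - \<xi>p)" and xm: "exp (- \<xi>m) = C * (1 - \<xi>m)"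
    and "(\<lambda>t. tangent_gap C (c + \<xi>p) (\<phi> t)) integrable_on {s..r}"
    and rng: "\<And>t. t \<in> {s<..<r} \<Longrightarrow> c \<le> \<phi> t \<and> \<phi> t \<le> c + \<xi>p - \<xi>m"
  shows "integral {s..r} (\<lambda>t. tangent_gap C (c + \<xi>p) (\<phi> t)) \<le> 0"
proof -
  \<comment> \<open>Tangency at c + \<xi>p puts the two zeros of the gap exactly at the ends of the
    prescribed range.\<close>
  have z: "tangent_gap C (c + \<xi>p) c = 0" "tangent_gap C (c + \<xi>p) (c + \<xi>p - \<xi>m) = 0"
    using tangent_gap_contact[OF xp, of c] tangent_gap_contact[OF xm, of "c + \<xi>p - \<xi>m"] by auto
  have "tangent_gap C (c + \<xi>p) (\<phi> t) \<le> 0" if "t \<in> {s<..<r}" for t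
    by (rule tangent_gap_le_0_between[of _ _ c "c + \<xi>p - \<xi>m"]) (use z rng that in auto)
  then show ?thesis by (rule integral_Icc_nonpos[OF assms(3)])
qed

text \<open>By convexity the gap of a monotone function is positive at most on an initial segment, so
  cutting off an initial segment cannot turn a vanishing integral into a positive one.\<close>

lemma gap_of_tail:
  fixes \<phi> :: "real \<Rightarrow> real"
  assumes "0 \<le> s" "s < r"
    and int: "((\<lambda>t. tangent_gap C a (\<phi> t)) has_integral 0) {0..r}"
    and r: "tangent_gap C a (\<phi> r) \<le> 0"
    and mono: "mono_on {0<..r} \<phi> \<or> antimono_on {0<..r} \<phi>"
  shows "integral {s..r} (\<lambda>t. tangent_gap C a (\<phi> t)) \<le> 0"
proof (cases "s = 0")
  case True
  then show ?thesis using int by (simp add: integral_unique)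
next
  case False
  let ?g = "\<lambda>t. tangent_gap C a (\<phi> t)"
  have gi: "?g integrable_on {0..r}" using int by blast
  have gle: "?g t' \<le> 0" if "0 < t" "t \<le> t'" "t' \<le> r" "?g t \<le> 0" for t t'
  proof -
    from mono show ?thesis
    proof
      assume "mono_on {0<..r} \<phi>"
      then have "\<phi> t \<le> \<phi> t'" "\<phi> t' \<le> \<phi> r" using that by (auto intro: mono_onD)
      then show ?thesis by (rule tangent_gap_le_0_between[OF that(4) r])
    next
      assume "antimono_on {0<..r} \<phi>"
      then have "\<phi> r \<le> \<phi> t'" "\<phi> t' \<le> \<phi> t"
        using that monotone_onD[of "{0<..r}" "(\<le>)" "(\<ge>)" \<phi>] by auto
      then show ?thesis by (rule tangent_gap_le_0_between[OF r that(4)])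
    qed
  qed
  have i1: "?g integrable_on {0..s}" "?g integrable_on {s..r}"
    using gi assms by (auto intro: integrable_on_subinterval)
  have sum: "integral {0..s} ?g + integral {s..r} ?g = 0"
    using Henstock_Kurzweil_Integration.integral_combine[of 0 s r ?g] assms gi int by (simp add: integral_unique)
  show ?thesis
  proof (cases "?g s \<le> 0")
    case True
    then have "integral {s..r} ?g \<le> integral {s..r} (\<lambda>t. 0)"
      using i1 gle[of s] assms False by (intro integral_le) auto
    then show ?thesis by simp
  next
    case gs: False
    \<comment> \<open>By \<open>gle\<close>, a nonpositive value before s would persist up to s; so
      the part cut off has nonnegative integral, and the total is 0.\<close>
    have "?g t \<ge> 0" if "t \<in> {0<..<s}" for t
      using gs gle[of t s] that assms(2) by (metis greaterThanLessThan_iff less_imp_le linear)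
    then have "integral {0..s} (\<lambda>t. - ?g t) \<le> 0"
      using i1 by (intro integral_Icc_nonpos integrable_neg) auto
    then show ?thesis using sum by simp
  qed
qed

section \<open>The parameters \<open>\<xi>\<close>, \<open>u\<close> and \<open>v\<close>\<close>

text \<open>This turns the equation into a level set of (1 - \<xi>) * exp \<xi>, which increases up
  to its maximum 1 at \<xi> = 0 and decreases afterwards. For C > 1 the level 1 / C is taken once on
  each side of 0.\<close>

lemma xi_equation_iff:
  fixes C \<xi> :: real
  shows "exp (- \<xi>) = C * (1 - \<xi>) \<longleftrightarrow> C * ((1 - \<xi>) * exp \<xi>) = 1"
proof -
  have "exp (- \<xi>) = C * (1 - \<xi>) \<longleftrightarrow> exp (- \<xi>) * exp \<xi> = C * (1 - \<xi>) * exp \<xi>" by simp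
  also have "\<dots> \<longleftrightarrow> C * ((1 - \<xi>) * exp \<xi>) = 1" by (auto simp: exp_minus mult.assoc)
  finally show ?thesis .
qed

lemma one_minus_mult_exp_strict_antimono:
  fixes a b :: real
  assumes "0 \<le> a" "a < b"
  shows "(1 - b) * exp b < (1 - a) * exp a"
  by (rule DERIV_neg_imp_decreasing_open[OF assms(2)])
     (use assms in \<open>auto intro!: derivative_eq_intros continuous_intros exI simp: algebra_simps\<close>)

lemma one_minus_mult_exp_strict_mono:
  fixes a b :: real
  assumes "a < b" "b \<le> 0"
  shows "(1 - a) * exp a < (1 - b) * exp b"
  by (rule DERIV_pos_imp_increasing_open[OF assms(1)])
     (use assms in \<open>auto intro!: derivative_eq_intros continuous_intros exI simp: algebra_simps mult_less_0_iff\<close>)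

lemma xi_plus:
  assumes C: "C > 1"
  shows "exp (- xi_plus C) = C * (1 - xi_plus C)" "0 < xi_plus C" "xi_plus C < 1"
proof -
  let ?P = "\<lambda>\<xi>. exp (- \<xi>) = C * (1 - \<xi>) \<and> 0 < \<xi> \<and> \<xi> < 1"
  have "\<exists>\<xi>. 0 \<le> \<xi> \<and> \<xi> \<le> 1 \<and> C * ((1 - \<xi>) * exp \<xi>) = 1"
    by (rule IVT2') (use C in \<open>auto intro!: continuous_intros\<close>)
  then obtain \<xi> where \<xi>: "0 \<le> \<xi>" "\<xi> \<le> 1" "C * ((1 - \<xi>) * exp \<xi>) = 1" by blast
  have P: "?P \<xi>"
    using \<xi> C by (auto simp: xi_equation_iff less_le)
  have U: "y = \<xi>" if "?P y" for y
  proof (rule ccontr)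
    assume "y \<noteq> \<xi>"
    then have "(1 - y) * exp y \<noteq> (1 - \<xi>) * exp \<xi>"
      using one_minus_mult_exp_strict_antimono[of y \<xi>] one_minus_mult_exp_strict_antimono[of \<xi> y] that P by linarith
    moreover have "C * ((1 - y) * exp y) = C * ((1 - \<xi>) * exp \<xi>)"
      using that P unfolding xi_equation_iff by metis
    ultimately show False using C by auto
  qed
  have "?P (xi_plus C)"
    unfolding xi_plus_def by (rule theI[of ?P, OF P U])
  then show "exp (- xi_plus C) = C * (1 - xi_plus C)" "0 < xi_plus C" "xi_plus C < 1" by auto
qed

lemma xi_minus:
  assumes C: "C > 1"
  shows "exp (- xi_minus C) = C * (1 - xi_minus C)" "xi_minus C < 0"
proof -
  let ?P = "\<lambda>\<xi>. exp (- \<xi>) = C * (1 - \<xi>) \<and> \<xi> < 0"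
  \<comment> \<open>No explicit left endpoint is at hand for the intermediate value theorem; the
    limit at minus infinity supplies z, and \<open>min z 0\<close> keeps it on the correct
    side.\<close>
  have "((\<lambda>\<xi>::real. (1 - \<xi>) * exp \<xi>) \<longlongrightarrow> 0) at_bot" by real_asymp
  then have "eventually (\<lambda>\<xi>. (1 - \<xi>) * exp \<xi> < 1 / C) at_bot"
    by (rule order_tendstoD(2)) (use C in auto)
  then obtain z where "\<And>y. y \<le> z \<Longrightarrow> (1 - y) * exp y < 1 / C"
    unfolding eventually_at_bot_linorder by blast
  then have "(1 - min z 0) * exp (min z 0) < 1 / C" by simp
  then have "C * ((1 - min z 0) * exp (min z 0)) < C * (1 / C)"
    by (rule mult_strict_left_mono) (use C in simp)
  then have z: "C * ((1 - min z 0) * exp (min z 0)) \<le> 1" using C by simp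
  have "\<exists>\<xi>. min z 0 \<le> \<xi> \<and> \<xi> \<le> 0 \<and> C * ((1 - \<xi>) * exp \<xi>) = 1"
    by (rule IVT') (use C z in \<open>auto intro!: continuous_intros\<close>)
  then obtain \<xi> where \<xi>: "\<xi> \<le> 0" "C * ((1 - \<xi>) * exp \<xi>) = 1" by blast
  have P: "?P \<xi>"
    using \<xi> C by (auto simp: xi_equation_iff less_le)
  have U: "y = \<xi>" if "?P y" for y
  proof (rule ccontr)
    assume "y \<noteq> \<xi>"
    then have "(1 - y) * exp y \<noteq> (1 - \<xi>) * exp \<xi>"
      using one_minus_mult_exp_strict_mono[of y \<xi>] one_minus_mult_exp_strict_mono[of \<xi> y] that P by linarith
    moreover have "C * ((1 - y) * exp y) = C * ((1 - \<xi>) * exp \<xi>)"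
      using that P unfolding xi_equation_iff by metis
    ultimately show False using C by auto
  qed
  have "?P (xi_minus C)"
    unfolding xi_minus_def by (rule theI[of ?P, OF P U])
  then show "exp (- xi_minus C) = C * (1 - xi_minus C)" "xi_minus C < 0" by auto
qed

text \<open>The left side is the slope of the tangent with tangency point \<xi>, which passes
  through (0, 1). The lemma removes C from the lines that separate the regions.\<close>

lemma C_exp_xi:
  fixes C \<xi> :: real
  assumes "exp (- \<xi>) = C * (1 - \<xi>)" "\<xi> < 1"
  shows "C * exp \<xi> = 1 / (1 - \<xi>)"
proof -
  have "C * exp \<xi> * (1 - \<xi>) = 1" using assms(1) unfolding xi_equation_iff by (simp add: mult_ac)
  then show ?thesis using assms(2) by (simp add: eq_divide_eq)
qed

text \<open>The quotient of the two slopes in \<open>C_exp_xi\<close>. It is the ratio of the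
  heights of the two ends of a tangent chord of the lower boundary, and makes every value of exp
  after a jump rational in the two \<xi>.\<close>

lemma exp_xi_diff:
  assumes "C > 1"
  shows "exp (xi_plus C - xi_minus C) = (1 - xi_minus C) / (1 - xi_plus C)"
    "exp (xi_minus C - xi_plus C) = (1 - xi_plus C) / (1 - xi_minus C)"
proof -
  note p = xi_plus[OF assms] and m = xi_minus[OF assms]
  have "C * exp (xi_plus C) = 1 / (1 - xi_plus C)" "C * exp (xi_minus C) = 1 / (1 - xi_minus C)"
    using C_exp_xi p m by auto
  then have "exp (xi_plus C) = 1 / (C * (1 - xi_plus C))" "exp (xi_minus C) = 1 / (C * (1 - xi_minus C))"
    using assms p m by (auto simp: eq_divide_eq mult_ac)
  then show "exp (xi_plus C - xi_minus C) = (1 - xi_minus C) / (1 - xi_plus C)"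
    "exp (xi_minus C - xi_plus C) = (1 - xi_plus C) / (1 - xi_minus C)"
    using assms p m by (auto simp: exp_diff)
qed

text \<open>The height at x1 of the line through (u, exp u) that touches the upper boundary at
  abscissa u + \<xi>. The contact point u is the last argument because \<open>u_plus\<close> and
  \<open>u_minus\<close> come from solving for it.\<close>

definition tangent_line :: "real \<Rightarrow> real \<Rightarrow> real \<Rightarrow> real" where
  "tangent_line \<xi> x1 u = exp u * ((x1 - u) / (1 - \<xi>) + 1)"

text \<open>The derivative changes sign only at u = x1 - \<xi>, where the tangency point is x1
  itself. This splits the tangents through a given point into the two families behind
  \<open>u_plus\<close> and \<open>u_minus\<close>.\<close>

lemma tangent_line_has_derivative:
  assumes "\<xi> < 1"
  shows "(tangent_line \<xi> x1 has_field_derivative (exp u * (x1 - u - \<xi>) / (1 - \<xi>))) (at u)"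
proof -
  define c where "c = 1 / (1 - \<xi>)"
  have c: "\<xi> * c = c - 1" using assms by (simp add: c_def field_simps)
  have "((\<lambda>u. exp u * ((x1 - u) * c + 1)) has_field_derivative (exp u * (x1 * c - u * c - \<xi> * c))) (at u)"
    unfolding c by (auto intro!: derivative_eq_intros simp: algebra_simps)
  moreover have "(\<lambda>u. exp u * ((x1 - u) * c + 1)) = tangent_line \<xi> x1"
    by (auto simp: tangent_line_def c_def)
  moreover have "exp u * (x1 * c - u * c - \<xi> * c) = exp u * (x1 - u - \<xi>) / (1 - \<xi>)"
    by (simp add: c_def diff_divide_distrib right_diff_distrib)
  ultimately show ?thesis by simp
qed

lemma continuous_on_tangent_line:
  assumes "\<xi> < 1"
  shows "continuous_on A (tangent_line \<xi> x1)"
  using tangent_line_has_derivative[OF assms] by (meson DERIV_isCont continuous_at_imp_continuous_on)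

lemma tangent_line_strict_antimono:
  assumes "\<xi> < 1" "x1 - \<xi> \<le> u" "u < u'"
  shows "tangent_line \<xi> x1 u' < tangent_line \<xi> x1 u"
proof (rule DERIV_neg_imp_decreasing_open[OF assms(3)])
  fix w assume "u < w" "w < u'"
  then have "exp w * (x1 - w - \<xi>) / (1 - \<xi>) < 0"
    using assms by (intro divide_neg_pos mult_pos_neg) auto
  then show "\<exists>y. (tangent_line \<xi> x1 has_real_derivative y) (at w) \<and> y < 0"
    using tangent_line_has_derivative[OF assms(1)] by blast
qed (rule continuous_on_tangent_line[OF assms(1)])

lemma tangent_line_strict_mono:
  assumes "\<xi> < 1" "u < u'" "u' \<le> x1 - \<xi>"
  shows "tangent_line \<xi> x1 u < tangent_line \<xi> x1 u'"
proof (rule DERIV_pos_imp_increasing_open[OF assms(2)])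
  fix w assume "u < w" "w < u'"
  then have "exp w * (x1 - w - \<xi>) / (1 - \<xi>) > 0"
    using assms by (intro divide_pos_pos mult_pos_pos) auto
  then show "\<exists>y. (tangent_line \<xi> x1 has_real_derivative y) (at w) \<and> y > 0"
    using tangent_line_has_derivative[OF assms(1)] by blast
qed (rule continuous_on_tangent_line[OF assms(1)])

lemma tangent_line_at_contact:
  assumes "exp (- \<xi>) = C * (1 - \<xi>)" "\<xi> < 1"
  shows "tangent_line \<xi> x1 (x1 - \<xi>) = C * exp x1"
proof -
  have "tangent_line \<xi> x1 (x1 - \<xi>) = exp x1 * exp (- \<xi>) * (1 / (1 - \<xi>))"
    using assms(2) by (simp add: tangent_line_def field_simps flip: exp_add)
  also have "\<dots> = C * exp x1" using assms by simp
  finally show ?thesis .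
qed

text \<open>Between u = x1 - \<xi> and u = x1 the height decreases strictly from C * exp x1 to exp
  x1, which is the vertical section of \<open>Omega C\<close> at x1. So membership in
  \<open>Omega C\<close> gives existence, and strictness gives uniqueness.\<close>

lemma u_plus:
  assumes C: "C > 1" and x: "x \<in> Omega C"
  shows "snd x = tangent_line (xi_plus C) (fst x) (u_plus C x)"
    "fst x - xi_plus C \<le> u_plus C x" "u_plus C x \<le> fst x"
proof -
  obtain x1 x2 where xx: "x = (x1, x2)" by force
  note p = xi_plus[OF C]
  let ?P = "\<lambda>u. x2 = tangent_line (xi_plus C) x1 u \<and> x1 - xi_plus C \<le> u \<and> u \<le> x1"
  have "\<exists>u. x1 - xi_plus C \<le> u \<and> u \<le> x1 \<and> tangent_line (xi_plus C) x1 u = x2"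
  proof (rule IVT2')
    show "tangent_line (xi_plus C) x1 x1 \<le> x2" using x by (simp add: xx Omega_def tangent_line_def)
    show "x2 \<le> tangent_line (xi_plus C) x1 (x1 - xi_plus C)"
      using x p by (simp add: xx Omega_def tangent_line_at_contact)
  qed (use p continuous_on_tangent_line in auto)
  then obtain u where u: "?P u" by blast
  have U: "y = u" if "?P y" for y
    using tangent_line_strict_antimono[of "xi_plus C" x1 u y] tangent_line_strict_antimono[of "xi_plus C" x1 y u]
      that u p by (metis less_irrefl linorder_less_linear)
  have "?P (u_plus C x)"
    unfolding u_plus_def xx prod.case tangent_line_def[symmetric] by (rule theI[of ?P, OF u U])
  then show "snd x = tangent_line (xi_plus C) (fst x) (u_plus C x)"
    "fst x - xi_plus C \<le> u_plus C x" "u_plus C x \<le> fst x" by (auto simp: xx)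
qed

lemma u_minus:
  assumes C: "C > 1" and x: "x \<in> Omega C"
  shows "snd x = tangent_line (xi_minus C) (fst x) (u_minus C x)"
    "fst x \<le> u_minus C x" "u_minus C x \<le> fst x - xi_minus C"
proof -
  obtain x1 x2 where xx: "x = (x1, x2)" by force
  note m = xi_minus[OF C]
  let ?P = "\<lambda>u. x2 = tangent_line (xi_minus C) x1 u \<and> x1 \<le> u \<and> u \<le> x1 - xi_minus C"
  have "\<exists>u. x1 \<le> u \<and> u \<le> x1 - xi_minus C \<and> tangent_line (xi_minus C) x1 u = x2"
  proof (rule IVT')
    show "tangent_line (xi_minus C) x1 x1 \<le> x2" using x by (simp add: xx Omega_def tangent_line_def)
    show "x2 \<le> tangent_line (xi_minus C) x1 (x1 - xi_minus C)"
      using x m by (simp add: xx Omega_def tangent_line_at_contact)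
  qed (use m continuous_on_tangent_line in auto)
  then obtain u where u: "?P u" by blast
  have U: "y = u" if "?P y" for y
    using tangent_line_strict_mono[of "xi_minus C" u y x1] tangent_line_strict_mono[of "xi_minus C" y u x1]
      that u m by (metis less_irrefl linorder_less_linear less_trans zero_less_one)
  have "?P (u_minus C x)"
    unfolding u_minus_def xx prod.case tangent_line_def[symmetric] by (rule theI[of ?P, OF u U])
  then show "snd x = tangent_line (xi_minus C) (fst x) (u_minus C x)"
    "fst x \<le> u_minus C x" "u_minus C x \<le> fst x - xi_minus C" by (auto simp: xx)
qed

text \<open>The hypothesis \<open>chord\<close> says that (x1, x2) lies on or below the chord of the
  lower boundary over w and lam. The line through (lam, exp lam) and the point then meets the curve
  again no further left than w, which is what bounds the jump lam - v later.\<close>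

lemma v_coord:
  assumes x1: "w \<le> x1" "x1 < lam" and x2: "exp x1 \<le> x2"
    and chord: "(lam - x1) * (exp lam - exp w) \<le> (exp lam - x2) * (lam - w)"
  shows "w \<le> v_coord lam (x1, x2)" "v_coord lam (x1, x2) \<le> x1" "v_coord lam (x1, x2) < lam"
    "(lam - x1) * (exp lam - exp (v_coord lam (x1, x2))) = (exp lam - x2) * (lam - v_coord lam (x1, x2))"
proof -
  define k where "k = (x2 - exp lam) / (x1 - lam)"
  have k: "k * (lam - x1) = exp lam - x2"
    using x1 by (simp add: k_def field_simps)
  let ?l = "\<lambda>v. exp v - exp lam + k * (lam - v)"
  let ?P = "\<lambda>v. v < lam \<and> (exp v - exp lam) / (v - lam) = k"
  have P_iff: "?P v \<longleftrightarrow> v < lam \<and> ?l v = 0" for v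
    by (auto simp: field_simps)
  have "\<exists>v. w \<le> v \<and> v \<le> x1 \<and> ?l v = 0"
  proof (rule IVT2')
    show "?l x1 \<le> 0" using x2 k by simp
    have "(lam - x1) * (exp lam - exp w) \<le> (lam - x1) * (k * (lam - w))"
      using chord by (simp add: k[symmetric] mult_ac)
    then show "0 \<le> ?l w" using x1 by simp
  qed (use x1 in \<open>auto intro!: continuous_intros\<close>)
  then obtain v where v: "w \<le> v" "v \<le> x1" "?l v = 0" by blast
  then have P: "?P v" unfolding P_iff using x1 by simp
  \<comment> \<open>Together with lam there would be three collinear points on the graph of exp; the
    mean value theorem on both gaps yields equal derivatives at distinct points.\<close>
  have no2: False if ab: "a < b" "b < lam" "?l a = 0" "?l b = 0" for a b
  proof -
    have D: "\<And>x. (exp has_real_derivative exp x) (at x)" by (rule DERIV_exp)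
    obtain z1 where z1: "a < z1" "z1 < b" "exp b - exp a = (b - a) * exp z1"
      using MVT2[OF ab(1), of exp exp] D by blast
    obtain z2 where z2: "b < z2" "z2 < lam" "exp lam - exp b = (lam - b) * exp z2"
      using MVT2[OF ab(2), of exp exp] D by blast
    have "(b - a) * exp z1 = (b - a) * k" using z1 ab by (simp add: algebra_simps)
    moreover have "(lam - b) * exp z2 = (lam - b) * k" using z2 ab by (simp add: algebra_simps)
    ultimately have "exp z1 = exp z2" using ab by simp
    then show False using z1 z2 by simp
  qed
  have U: "y = v" if "?P y" for y
    using no2[of y v] no2[of v y] that P unfolding P_iff by (metis linorder_less_linear)
  have "v_coord lam (x1, x2) = v"
    unfolding v_coord_def prod.case k_def[symmetric] by (rule the_equality[of ?P, OF P U])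
  moreover have "exp lam - exp v = k * (lam - v)" using v(3) by simp
  ultimately show "w \<le> v_coord lam (x1, x2)" "v_coord lam (x1, x2) \<le> x1" "v_coord lam (x1, x2) < lam"
    "(lam - x1) * (exp lam - exp (v_coord lam (x1, x2))) = (exp lam - x2) * (lam - v_coord lam (x1, x2))"
    using v(1,2) x1 by (simp_all add: k[symmetric])
qed

section \<open>Logarithmic profiles\<close>

text \<open>The antiderivatives used below have the form t * g t with g unbounded at 0. The
  fundamental theorem needs them continuous on the closed interval and differentiable only
  inside.\<close>

lemma continuous_on_Icc_times_at_0:
  fixes g :: "real \<Rightarrow> real"
  assumes "continuous_on {0<..} g" "((\<lambda>t. t * g t) \<longlongrightarrow> 0) (at_right 0)" "0 < m"
  shows "continuous_on {0..m} (\<lambda>t. t * g t)"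
  unfolding continuous_on_eq_continuous_within
proof
  fix t assume t: "t \<in> {0..m}"
  show "continuous (at t within {0..m}) (\<lambda>t. t * g t)"
  proof (cases "t = 0")
    case True
    have "((\<lambda>t. t * g t) \<longlongrightarrow> 0) (at 0 within {0..m})"
      using assms(2,3) by (simp add: at_within_Icc_at_right)
    then show ?thesis using True by (simp add: continuous_within)
  next
    case False
    then have "isCont g t" using assms(1) t by (simp add: continuous_on_eq_continuous_at)
    then have "isCont (\<lambda>t. t * g t) t" by (intro continuous_mult continuous_ident)
    then show ?thesis by (rule continuous_at_imp_continuous_at_within)
  qed
qed

text \<open>The integrand is a constant times t powr (- c); c < 1 makes the antiderivative
  continuous at 0. The result is written through the value of the integrand at m, the form needed
  when m is the right end of a subinterval.\<close>

lemma exp_ln_has_integral: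
  fixes \<alpha> c m w :: real
  assumes "c < 1" "0 < m" "0 < \<alpha>"
  shows "((\<lambda>t. exp (w + c * ln (\<alpha> / t))) has_integral (m * exp (w + c * ln (\<alpha> / m)) / (1 - c))) {0..m}"
proof -
  let ?F = "\<lambda>t. exp (w + c * ln \<alpha>) / (1 - c) * t powr (1 - c)"
  have "((\<lambda>t. exp (w + c * ln (\<alpha> / t))) has_integral (?F m - ?F 0)) {0..m}"
  proof (rule fundamental_theorem_of_calculus_interior)
    show "continuous_on {0..m} ?F" using assms by (intro continuous_intros continuous_on_powr') auto
    fix t assume t: "t \<in> {0<..<m}"
    have "(?F has_real_derivative (exp (w + c * ln \<alpha>) / (1 - c) * ((1 - c) * t powr (1 - c - 1)))) (at t)"
      using t by (intro DERIV_cmult has_real_derivative_powr) auto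
    also have "exp (w + c * ln \<alpha>) / (1 - c) * ((1 - c) * t powr (1 - c - 1)) = exp (w + c * ln \<alpha>) * t powr (- c)"
      using assms by simp
    also have "\<dots> = exp (w + c * ln (\<alpha> / t))"
      using t assms by (simp add: powr_def ln_div algebra_simps flip: exp_add)
    finally show "(?F has_vector_derivative exp (w + c * ln (\<alpha> / t))) (at t)"
      by (simp add: has_real_derivative_iff_has_vector_derivative)
  qed (use assms in auto)
  moreover have "?F m - ?F 0 = m * exp (w + c * ln (\<alpha> / m)) / (1 - c)"
  proof -
    have "exp (w + c * ln \<alpha>) * m powr (1 - c) = exp (ln m + (w + c * ln (\<alpha> / m)))"
      unfolding powr_def using assms by (simp add: ln_div algebra_simps flip: exp_add)
    also have "\<dots> = m * exp (w + c * ln (\<alpha> / m))"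
      unfolding exp_add[of "ln m"] using assms by simp
    finally show ?thesis using assms by simp
  qed
  ultimately show ?thesis by (simp only:)
qed

lemma ln_has_integral:
  fixes \<alpha> m :: real
  assumes "0 < m" "0 < \<alpha>"
  shows "((\<lambda>t. ln (\<alpha> / t)) has_integral (m * (ln (\<alpha> / m) + 1))) {0..m}"
proof -
  let ?F = "\<lambda>t. t * ln (\<alpha> / t) + t"
  have "((\<lambda>t. t * ln (\<alpha> / t)) \<longlongrightarrow> 0) (at_right 0)"
    using assms by real_asymp
  moreover have "continuous_on {0<..} (\<lambda>t. ln (\<alpha> / t))"
    using assms by (intro continuous_intros) auto
  ultimately have cont: "continuous_on {0..m} (\<lambda>t. t * ln (\<alpha> / t))"
    using assms by (intro continuous_on_Icc_times_at_0)
  have "((\<lambda>t. ln (\<alpha> / t)) has_integral (?F m - ?F 0)) {0..m}"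
  proof (rule fundamental_theorem_of_calculus_interior)
    show "continuous_on {0..m} ?F" using cont by (intro continuous_on_add continuous_on_id)
    fix t assume t: "t \<in> {0<..<m}"
    have "(?F has_real_derivative ln (\<alpha> / t)) (at t)"
      using t assms by (auto intro!: derivative_eq_intros simp: field_simps)
    then show "(?F has_vector_derivative ln (\<alpha> / t)) (at t)"
      by (simp add: has_real_derivative_iff_has_vector_derivative)
  qed (use assms in auto)
  then show ?thesis by (simp add: algebra_simps)
qed

lemma ln_squared_has_integral:
  fixes \<alpha> :: real
  assumes "0 < \<alpha>"
  shows "((\<lambda>t. (ln (\<alpha> / t))\<^sup>2) has_integral (2 * \<alpha>)) {0..\<alpha>}"
proof -
  let ?g = "\<lambda>t. (ln (\<alpha> / t))\<^sup>2 + 2 * ln (\<alpha> / t) + 2"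
  let ?F = "\<lambda>t. t * ?g t"
  have "((\<lambda>t. t * ?g t) \<longlongrightarrow> 0) (at_right 0)"
    using assms by real_asymp
  moreover have "continuous_on {0<..} ?g"
    using assms by (intro continuous_intros) auto
  ultimately have cont: "continuous_on {0..\<alpha>} ?F"
    using assms by (intro continuous_on_Icc_times_at_0)
  have "((\<lambda>t. (ln (\<alpha> / t))\<^sup>2) has_integral (?F \<alpha> - ?F 0)) {0..\<alpha>}"
  proof (rule fundamental_theorem_of_calculus_interior)
    show "continuous_on {0..\<alpha>} ?F" by (rule cont)
    fix t assume t: "t \<in> {0<..<\<alpha>}"
    have "(?F has_real_derivative (ln (\<alpha> / t))\<^sup>2) (at t)"
      using t assms by (auto intro!: derivative_eq_intros simp: field_simps power2_eq_square)
    then show "(?F has_vector_derivative (ln (\<alpha> / t))\<^sup>2) (at t)"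
      by (simp add: has_real_derivative_iff_has_vector_derivative)
  qed (use assms in auto)
  then show ?thesis using assms by (simp add: mult.commute)
qed

lemma quadratic_log_has_integral:
  fixes \<alpha> u \<xi> :: real
  assumes "0 < \<alpha>"
  shows "((\<lambda>t. (u + \<xi> * ln (\<alpha> / t))\<^sup>2) has_integral (u\<^sup>2 * \<alpha> + 2 * u * \<xi> * \<alpha> + 2 * \<xi>\<^sup>2 * \<alpha>)) {0..\<alpha>}"
proof -
  have "((\<lambda>t. u\<^sup>2 + 2 * u * \<xi> * ln (\<alpha> / t) + \<xi>\<^sup>2 * (ln (\<alpha> / t))\<^sup>2) has_integral
      (\<alpha> * u\<^sup>2 + 2 * u * \<xi> * (\<alpha> * (ln (\<alpha> / \<alpha>) + 1)) + \<xi>\<^sup>2 * (2 * \<alpha>))) {0..\<alpha>}"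
    using has_integral_const_real[of "u\<^sup>2" 0 \<alpha>] assms
    by (intro has_integral_add has_integral_mult_right ln_has_integral ln_squared_has_integral) auto
  moreover have "(\<lambda>t. u\<^sup>2 + 2 * u * \<xi> * ln (\<alpha> / t) + \<xi>\<^sup>2 * (ln (\<alpha> / t))\<^sup>2) = (\<lambda>t. (u + \<xi> * ln (\<alpha> / t))\<^sup>2)"
    by (simp add: fun_eq_iff power2_eq_square algebra_simps)
  ultimately show ?thesis using assms by (simp add: mult_ac)
qed

text \<open>Domination by a quadratic polynomial in the logarithm suffices for the identity and for
  all powers of exponent at most 2.\<close>

lemma quadratic_growth_log_integrable:
  fixes \<alpha> u \<xi> :: real
  assumes "0 < \<alpha>" and F: "F \<in> borel_measurable borel" "\<And>y. \<bar>F y\<bar> \<le> A + B * y\<^sup>2"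
  shows "(\<lambda>t. F (u + \<xi> * ln (\<alpha> / t))) absolutely_integrable_on {0..\<alpha>}"
proof (rule measurable_bounded_by_integrable_imp_absolutely_integrable)
  have [measurable]: "F \<in> borel_measurable borel" by (rule F)
  have "(\<lambda>t. F (u + \<xi> * ln (\<alpha> / t))) \<in> borel_measurable borel" by measurable
  then show "(\<lambda>t. F (u + \<xi> * ln (\<alpha> / t))) \<in> borel_measurable (lebesgue_on {0..\<alpha>})"
    by (intro measurable_restrict_space1 measurable_completion) simp
  show "(\<lambda>t. A + B * (u + \<xi> * ln (\<alpha> / t))\<^sup>2) integrable_on {0..\<alpha>}"
    using quadratic_log_has_integral[OF assms(1), of u \<xi>]
    by (intro integrable_add integrable_on_mult_right integrable_const_ivl) blast
qed (use F in auto)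

section \<open>Profiles with a logarithmic and a constant part\<close>

definition log_profile :: "real \<Rightarrow> real \<Rightarrow> real \<Rightarrow> real \<Rightarrow> real" where
  "log_profile \<xi> u \<alpha> t = u + \<xi> * ln (\<alpha> / t) * indicat_real {0<..<\<alpha>} t"

lemma log_profile_has_integral:
  fixes F :: "real \<Rightarrow> real"
  assumes "0 \<le> r" "0 \<le> \<alpha>" "((\<lambda>t. F (u + \<xi> * ln (\<alpha> / t))) has_integral I) {0..min r \<alpha>}"
  shows "((\<lambda>t. F (log_profile \<xi> u \<alpha> t)) has_integral (I + (r - min r \<alpha>) * F u)) {0..r}"
proof (rule has_integral_combine[of 0 "min r \<alpha>"])
  show "((\<lambda>t. F (log_profile \<xi> u \<alpha> t)) has_integral I) {0..min r \<alpha>}"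
    by (rule has_integral_spike_finite[OF _ _ assms(3), of "{0, \<alpha>}"]) (auto simp: log_profile_def)
  have "((\<lambda>t. F u) has_integral ((r - min r \<alpha>) * F u)) {min r \<alpha>..r}"
    using has_integral_const_real[of "F u" "min r \<alpha>" r] by simp
  then show "((\<lambda>t. F (log_profile \<xi> u \<alpha> t)) has_integral ((r - min r \<alpha>) * F u)) {min r \<alpha>..r}"
    by (rule has_integral_spike_finite[of "{r}", rotated 2])
       (auto simp: log_profile_def min_def split: if_splits)
qed (use assms in auto)

lemma log_profile_absolutely_integrable:
  fixes F :: "real \<Rightarrow> real"
  assumes "0 \<le> \<alpha>" "\<alpha> \<le> 1" "0 < \<alpha> \<Longrightarrow> (\<lambda>t. F (u + \<xi> * ln (\<alpha> / t))) absolutely_integrable_on {0..\<alpha>}"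
  shows "(\<lambda>t. F (log_profile \<xi> u \<alpha> t)) absolutely_integrable_on {0..1}"
proof (rule absolutely_integrable_onI)
  have *: "(\<lambda>t. G (log_profile \<xi> u \<alpha> t)) integrable_on {0..1}"
    if "0 < \<alpha> \<Longrightarrow> (\<lambda>t. G (u + \<xi> * ln (\<alpha> / t))) integrable_on {0..\<alpha>}" for G :: "real \<Rightarrow> real"
  proof -
    have "(\<lambda>t. G (u + \<xi> * ln (\<alpha> / t))) integrable_on {0..min 1 \<alpha>}"
      using that assms by (cases "\<alpha> = 0") (auto simp: min_absorb2 integrable_on_def)
    then show ?thesis
      using log_profile_has_integral[of 1 \<alpha> G u \<xi>] assms(1) by (auto simp: integrable_on_def)
  qed
  show "(\<lambda>t. F (log_profile \<xi> u \<alpha> t)) integrable_on {0..1}"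
    using assms(3) by (intro *) (auto simp: absolutely_integrable_on_def)
  show "(\<lambda>t. norm (F (log_profile \<xi> u \<alpha> t))) integrable_on {0..1}"
    using assms(3) by (intro *[of "\<lambda>y. norm (F y)"]) (auto simp: absolutely_integrable_on_def)
qed

lemma log_profile_id_integrable:
  assumes "0 \<le> \<alpha>" "\<alpha> \<le> 1"
  shows "log_profile \<xi> u \<alpha> absolutely_integrable_on {0..1}"
proof -
  have "\<bar>y\<bar> \<le> 1 + 1 * y\<^sup>2" for y :: real
  proof -
    have "0 \<le> (\<bar>y\<bar> - 1 / 2)\<^sup>2" by simp
    then show ?thesis unfolding power2_eq_square by (simp add: algebra_simps)
  qed
  then have "(\<lambda>t. (\<lambda>y. y) (log_profile \<xi> u \<alpha> t)) absolutely_integrable_on {0..1}"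
    by (intro log_profile_absolutely_integrable[OF assms]
        quadratic_growth_log_integrable[where A = 1 and B = 1]) auto
  then show ?thesis by simp
qed

lemma log_profile_eq_min:
  assumes "0 < r" "0 < \<alpha>"
  shows "log_profile \<xi> u \<alpha> r = u + \<xi> * ln (\<alpha> / min r \<alpha>)"
  using assms by (auto simp: log_profile_def min_def indicator_def)

text \<open>Let y be the value at r. After division by r the two integrals describe the point at
  fraction min r \<alpha> / r of the way from (y, exp y) to the tangency point of the tangent with
  contact y. For r \<le> \<alpha> it is the tangency point itself, so the logarithm keeps its
  averages on the upper boundary.\<close>

lemma log_profile_integrals:
  assumes "0 < r" "0 \<le> \<alpha>"
  shows "(log_profile \<xi> u \<alpha> has_integral (min r \<alpha> * \<xi> + r * log_profile \<xi> u \<alpha> r)) {0..r}"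
    and "\<xi> < 1 \<Longrightarrow> ((\<lambda>t. exp (log_profile \<xi> u \<alpha> t)) has_integral
      (exp (log_profile \<xi> u \<alpha> r) * (r + min r \<alpha> * \<xi> / (1 - \<xi>)))) {0..r}"
proof -
  define m where "m = min r \<alpha>"
  have m: "\<alpha> = 0 \<and> m = 0 \<or> 0 < \<alpha> \<and> 0 < m"
    using assms by (auto simp: m_def min_def)
  have ur: "(r - m) * F u = (r - m) * F (log_profile \<xi> u \<alpha> r)" for F :: "real \<Rightarrow> real"
    using assms by (auto simp: m_def min_def log_profile_def)
  let ?p = "log_profile \<xi> u \<alpha> r"
  have "((\<lambda>t. u + \<xi> * ln (\<alpha> / t)) has_integral (m * (?p + \<xi>))) {0..m}"
    using m
  proof
    assume "0 < \<alpha> \<and> 0 < m"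
    then have "((\<lambda>t. u + \<xi> * ln (\<alpha> / t)) has_integral (m * u + \<xi> * (m * (ln (\<alpha> / m) + 1)))) {0..m}"
      using has_integral_const_real[of u 0 m]
      by (intro has_integral_add has_integral_mult_right ln_has_integral) auto
    then show ?thesis using assms \<open>0 < \<alpha> \<and> 0 < m\<close>
      by (simp add: log_profile_eq_min m_def[symmetric] algebra_simps)
  qed auto
  from log_profile_has_integral[of r \<alpha> "\<lambda>y. y", unfolded m_def[symmetric], OF _ assms(2) this]
  show "(log_profile \<xi> u \<alpha> has_integral (min r \<alpha> * \<xi> + r * ?p)) {0..r}"
    unfolding ur[of "\<lambda>y. y"] m_def[symmetric] using assms by (simp add: algebra_simps)
  assume \<xi>: "\<xi> < 1"
  have "((\<lambda>t. exp (u + \<xi> * ln (\<alpha> / t))) has_integral (m * exp ?p / (1 - \<xi>))) {0..m}"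
    using m
  proof
    assume "0 < \<alpha> \<and> 0 < m"
    then show ?thesis using assms exp_ln_has_integral[OF \<xi>, of m \<alpha> u]
      by (simp add: log_profile_eq_min m_def[symmetric])
  qed auto
  from log_profile_has_integral[of r \<alpha> exp, unfolded m_def[symmetric], OF _ assms(2) this]
  have "((\<lambda>t. exp (log_profile \<xi> u \<alpha> t)) has_integral (m * exp ?p / (1 - \<xi>) + (r - m) * exp ?p)) {0..r}"
    unfolding ur[of exp] using assms by simp
  moreover have "m * exp ?p / (1 - \<xi>) + (r - m) * exp ?p = exp ?p * (r + m * \<xi> / (1 - \<xi>))"
    using \<xi> by (simp add: field_simps)
  ultimately show "((\<lambda>t. exp (log_profile \<xi> u \<alpha> t)) has_integral
      (exp ?p * (r + min r \<alpha> * \<xi> / (1 - \<xi>)))) {0..r}"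
    by (simp add: m_def)
qed

lemma log_profile_antimono:
  assumes "0 \<le> \<xi>" "0 < t" "t \<le> t'"
  shows "log_profile \<xi> u \<alpha> t' \<le> log_profile \<xi> u \<alpha> t"
proof (cases "t' < \<alpha>")
  case True
  have "ln (\<alpha> / t') \<le> ln (\<alpha> / t)"
    using assms True by (simp add: frac_le)
  then show ?thesis using assms True by (simp add: log_profile_def mult_left_mono)
next
  case False
  then show ?thesis using assms by (auto simp: log_profile_def indicator_def)
qed

text \<open>Reflection transfers monotonicity from \<xi> \<ge> 0 to \<xi> < 0, so that one profile
  serves for both \<open>phi_plus\<close> and \<open>phi_minus\<close>.\<close>

lemma log_profile_uminus: "log_profile (- \<xi>) (- u) \<alpha> t = - log_profile \<xi> u \<alpha> t"
  by (simp add: log_profile_def)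

text \<open>By \<open>log_profile_integrals\<close> the averages over (0, r) lie on the tangent
  whose contact point is the value at r; for that tangent the gap integral vanishes, whichever side
  of \<alpha> contains r.\<close>

lemma log_profile_gap_integral_zero:
  assumes xi: "exp (- \<xi>) = C * (1 - \<xi>)" "\<xi> < 1" and "0 < r" "0 \<le> \<alpha>"
  shows "((\<lambda>t. tangent_gap C (log_profile \<xi> u \<alpha> r + \<xi>) (log_profile \<xi> u \<alpha> t)) has_integral 0) {0..r}"
proof -
  define p m where "p = log_profile \<xi> u \<alpha> r" and "m = min r \<alpha>"
  have q: "C * exp (p + \<xi>) = exp p / (1 - \<xi>)"
    using C_exp_xi[OF xi] by (metis exp_add mult.left_commute mult.right_neutral times_divide_eq_right)
  have "(1 - (p + \<xi>)) * (r - 0) + (m * \<xi> + r * p) = (1 - \<xi>) * r + m * \<xi>"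
    by (simp add: algebra_simps)
  then have "exp p * (r + m * \<xi> / (1 - \<xi>)) - C * exp (p + \<xi>) * ((1 - (p + \<xi>)) * (r - 0) + (m * \<xi> + r * p)) = 0"
    unfolding q using xi(2) by (simp add: field_simps)
  with tangent_gap_has_integral[OF log_profile_integrals(1,2)[OF assms(3,4), of \<xi> u], of C "p + \<xi>"] xi(2) assms(3)
  show ?thesis by (simp add: p_def m_def)
qed

lemma log_profile_gap:
  assumes xi: "exp (- \<xi>) = C * (1 - \<xi>)" "\<xi> < 1" and "0 \<le> s" "s < r" "0 \<le> \<alpha>"
  shows "\<exists>a. integral {s..r} (\<lambda>t. tangent_gap C a (log_profile \<xi> u \<alpha> t)) \<le> 0"
proof
  show "integral {s..r} (\<lambda>t. tangent_gap C (log_profile \<xi> u \<alpha> r + \<xi>) (log_profile \<xi> u \<alpha> t)) \<le> 0"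
  proof (rule gap_of_tail)
    show "mono_on {0<..r} (log_profile \<xi> u \<alpha>) \<or> antimono_on {0<..r} (log_profile \<xi> u \<alpha>)"
    proof (cases "0 \<le> \<xi>")
      case True
      then show ?thesis using log_profile_antimono by (auto simp: monotone_on_def)
    next
      case False
      then show ?thesis using log_profile_antimono[of "- \<xi>" _ _ "- u" \<alpha>]
        by (auto simp: monotone_on_def log_profile_uminus)
    qed
  qed (use assms tangent_gap_contact log_profile_gap_integral_zero in auto)
qed

section \<open>Powers of the logarithm\<close>

lemma abs_powr_le_quadratic:
  fixes y q :: real
  assumes "0 \<le> q" "q \<le> 2"
  shows "\<bar>y\<bar> powr q \<le> 1 + y\<^sup>2"
proof (cases "\<bar>y\<bar> \<le> 1")
  case True
  then have "\<bar>y\<bar> powr q \<le> 1" using assms by (intro powr_le1) auto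
  then show ?thesis using zero_le_power2[of y] by linarith
next
  case False
  then have "\<bar>y\<bar> powr q \<le> \<bar>y\<bar> powr 2" using assms by (intro powr_mono) auto
  also have "\<dots> = y\<^sup>2" using False by (simp add: powr_numeral)
  finally show ?thesis by simp
qed

text \<open>The substitution s = u + \<xi> * ln (\<alpha> / t) maps (0, \<alpha>) onto the half-line
  above u and turns dt into an exponential weight. This is the origin of the integral in
  \<open>b_cand\<close>.\<close>

lemma log_substitution:
  fixes \<alpha> \<xi> u :: real
  assumes "0 < \<alpha>" "0 < \<xi>" and H: "(\<lambda>t. H (u + \<xi> * ln (\<alpha> / t))) absolutely_integrable_on {0..\<alpha>}"
  shows "integral {0..\<alpha>} (\<lambda>t. H (u + \<xi> * ln (\<alpha> / t)))
    = \<alpha> / \<xi> * exp (u / \<xi>) * (LINT s:{u<..}|lebesgue. H s * exp (- s / \<xi>))"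
proof -
  define g where "g = (\<lambda>s. \<alpha> * exp ((u - s) / \<xi>))"
  define g' where "g' = (\<lambda>s. - (\<alpha> / \<xi>) * exp ((u - s) / \<xi>))"
  let ?f = "\<lambda>t. H (u + \<xi> * ln (\<alpha> / t))"
  have der: "(g has_field_derivative g' s) (at s within {u<..})" for s
    unfolding g_def g'_def using assms by (auto intro!: derivative_eq_intros simp: field_simps)
  have inj: "inj_on g {u<..}"
    using assms by (auto simp: g_def inj_on_def)
  have img: "g ` {u<..} = {0<..<\<alpha>}"
  proof safe
    fix s assume "u < s"
    then show "g s \<in> {0<..<\<alpha>}" using assms by (auto simp: g_def mult_less_cancel_left1 divide_neg_pos)
  next
    fix t assume t: "t \<in> {0<..<\<alpha>}"
    have "ln (\<alpha> / t) > 0" using t by (intro ln_gt_zero) auto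
    then have "u + \<xi> * ln (\<alpha> / t) \<in> {u<..}" using assms by simp
    moreover have "g (u + \<xi> * ln (\<alpha> / t)) = t"
      using assms t by (simp add: g_def exp_minus)
    ultimately show "t \<in> g ` {u<..}" by (metis imageI)
  qed
  have fg: "?f (g s) = H s" for s
    using assms by (simp add: g_def ln_mult ln_div exp_minus[symmetric] flip: exp_minus)
  have f: "?f absolutely_integrable_on g ` {u<..}"
    unfolding img using H by (rule set_integrable_subset) auto
  have cv: "(\<lambda>s. \<bar>g' s\<bar> * ?f (g s)) absolutely_integrable_on {u<..} \<and>
      integral {u<..} (\<lambda>s. \<bar>g' s\<bar> * ?f (g s)) = integral (g ` {u<..}) ?f"
    using has_absolute_integral_change_of_variables_1'[OF _ der inj, of ?f "integral (g ` {u<..}) ?f"] f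
    by auto
  have eq: "(\<lambda>s. \<bar>g' s\<bar> * ?f (g s)) = (\<lambda>s. \<alpha> / \<xi> * exp (u / \<xi>) * (H s * exp (- s / \<xi>)))"
  proof
    fix s
    have "\<bar>g' s\<bar> = \<alpha> / \<xi> * (exp (u / \<xi>) * exp (- s / \<xi>))"
      using assms by (simp add: g'_def abs_mult diff_divide_distrib flip: exp_add)
    then show "\<bar>g' s\<bar> * ?f (g s) = \<alpha> / \<xi> * exp (u / \<xi>) * (H s * exp (- s / \<xi>))"
      unfolding fg by (simp add: mult_ac)
  qed
  have "integral {0..\<alpha>} ?f = integral (g ` {u<..}) ?f"
    unfolding img by (rule integral_open_interval_real)
  also have "\<dots> = (LINT s:{u<..}|lebesgue. \<bar>g' s\<bar> * ?f (g s))"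
    using cv set_lebesgue_integral_eq_integral(2) by metis
  also have "\<dots> = \<alpha> / \<xi> * exp (u / \<xi>) * (LINT s:{u<..}|lebesgue. H s * exp (- s / \<xi>))"
    unfolding eq by (rule set_integral_mult_right)
  finally show ?thesis .
qed

lemma abs_powr_has_real_derivative:
  fixes y p :: real
  assumes "y \<noteq> 0"
  shows "((\<lambda>y. \<bar>y\<bar> powr p) has_real_derivative (p * (\<bar>y\<bar> powr (p - 1) * sgn y))) (at y)"
proof (cases "y > 0")
  case True
  have "((\<lambda>y. y powr p) has_real_derivative (p * y powr (p - 1))) (at y)"
    using True by (rule has_real_derivative_powr)
  then have "((\<lambda>y. \<bar>y\<bar> powr p) has_real_derivative (p * y powr (p - 1))) (at y)"
    by (rule has_field_derivative_transform_within_open[where S = "{0<..}"]) (use True in auto)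
  then show ?thesis using True by simp
next
  case False
  then have y: "y < 0" using assms by simp
  have "((\<lambda>y. (- y) powr p) has_real_derivative (p * (- y) powr (p - 1) * (- 1))) (at y)"
    using y by (auto intro!: derivative_eq_intros)
  then have "((\<lambda>y. \<bar>y\<bar> powr p) has_real_derivative (p * (- y) powr (p - 1) * (- 1))) (at y)"
    by (rule has_field_derivative_transform_within_open[where S = "{..<0}"]) (use y in auto)
  then show ?thesis using y by simp
qed

text \<open>Integration by parts: with G the logarithmic function, t * G' t = - \<xi>, so the
  derivative of t * \<bar>G t\<bar> powr p is the integrand minus \<xi> * p times a power of
  exponent p - 1. The boundary term is \<alpha> * \<bar>u\<bar> powr p, and
  \<open>log_substitution\<close> handles the rest.\<close>

lemma abs_powr_log_has_integral:
  fixes \<alpha> \<xi> u p :: real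
  assumes "0 < \<alpha>" "0 < \<xi>" and p: "1 < p" "p \<le> 2"
  shows "((\<lambda>t. \<bar>u + \<xi> * ln (\<alpha> / t)\<bar> powr p) has_integral
    (\<alpha> * (\<bar>u\<bar> powr p + p * exp (u / \<xi>) *
      (LINT s:{u<..}|lebesgue. \<bar>s\<bar> powr (p - 1) * sgn s * exp (- s / \<xi>))))) {0..\<alpha>}"
proof -
  define G where "G = (\<lambda>t. u + \<xi> * ln (\<alpha> / t))"
  define H where "H = (\<lambda>y::real. \<bar>y\<bar> powr (p - 1) * sgn y)"
  have Hb: "\<bar>H y\<bar> \<le> 1 + 1 * y\<^sup>2" for y
    using abs_powr_le_quadratic[of "p - 1" y] p by (auto simp: H_def abs_mult sgn_if)
  have Hi: "(\<lambda>t. H (G t)) absolutely_integrable_on {0..\<alpha>}"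
    unfolding G_def by (rule quadratic_growth_log_integrable[OF assms(1) _ Hb]) (simp add: H_def)
  let ?F = "\<lambda>t. t * \<bar>G t\<bar> powr p"
  have cont: "continuous_on {0..\<alpha>} ?F"
  proof (rule continuous_on_Icc_times_at_0)
    show "continuous_on {0<..} (\<lambda>t. \<bar>G t\<bar> powr p)"
      unfolding G_def using assms by (intro continuous_on_powr' continuous_intros) auto
    have "((\<lambda>t. t * (1 + (u + \<xi> * ln (\<alpha> / t))\<^sup>2)) \<longlongrightarrow> 0) (at_right 0)"
      using assms by real_asymp
    then show "(?F \<longlongrightarrow> 0) (at_right 0)"
    proof (rule Lim_null_comparison[rotated])
      show "\<forall>\<^sub>F t in at_right 0. norm (t * \<bar>G t\<bar> powr p) \<le> t * (1 + (u + \<xi> * ln (\<alpha> / t))\<^sup>2)"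
        using eventually_at_right_less[of 0]
      proof eventually_elim
        case (elim t)
        then show ?case using abs_powr_le_quadratic[of p "G t"] p
          by (simp add: abs_mult G_def mult_left_mono)
      qed
    qed
  qed (rule assms)
  have "((\<lambda>t. \<bar>G t\<bar> powr p - \<xi> * p * H (G t)) has_integral (?F \<alpha> - ?F 0)) {0..\<alpha>}"
  \<comment> \<open>The exceptional point is the only possible zero of G, where
    \<open>abs_powr_has_real_derivative\<close> gives nothing.\<close>
  proof (rule fundamental_theorem_of_calculus_interior_strong[where S = "{\<alpha> * exp (u / \<xi>)}"])
    fix t assume t: "t \<in> {0<..<\<alpha>} - {\<alpha> * exp (u / \<xi>)}"
    have "G t \<noteq> 0"
    proof
      assume "G t = 0"
      then have "ln (\<alpha> / t) = - (u / \<xi>)" using assms(2) by (simp add: G_def field_simps)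
      then have "\<alpha> / t = exp (- (u / \<xi>))" using t by (metis DiffD1 divide_pos_pos exp_ln greaterThanLessThan_iff assms(1))
      then show False using t by (simp add: exp_minus field_simps)
    qed
    have G': "(G has_real_derivative (- \<xi> / t)) (at t)"
      unfolding G_def using t assms by (auto intro!: derivative_eq_intros simp: field_simps)
    have "(?F has_real_derivative (1 * \<bar>G t\<bar> powr p + p * (\<bar>G t\<bar> powr (p - 1) * sgn (G t)) * (- \<xi> / t) * t)) (at t)"
      by (intro DERIV_mult DERIV_ident DERIV_chain2[OF abs_powr_has_real_derivative[OF \<open>G t \<noteq> 0\<close>] G'])
    also have "1 * \<bar>G t\<bar> powr p + p * (\<bar>G t\<bar> powr (p - 1) * sgn (G t)) * (- \<xi> / t) * t = \<bar>G t\<bar> powr p - \<xi> * p * H (G t)"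
      using t by (simp add: H_def)
    finally show "(?F has_vector_derivative (\<bar>G t\<bar> powr p - \<xi> * p * H (G t))) (at t)"
      by (simp add: has_real_derivative_iff_has_vector_derivative)
  qed (use assms cont in auto)
  moreover have "?F \<alpha> - ?F 0 = \<alpha> * \<bar>u\<bar> powr p" using assms by (simp add: G_def)
  ultimately have 1: "((\<lambda>t. \<bar>G t\<bar> powr p - \<xi> * p * H (G t)) has_integral (\<alpha> * \<bar>u\<bar> powr p)) {0..\<alpha>}"
    by (simp only:)
  have "((\<lambda>t. H (G t)) has_integral integral {0..\<alpha>} (\<lambda>t. H (G t))) {0..\<alpha>}"
    using Hi set_lebesgue_integral_eq_integral(1) by (intro integrable_integral) blast
  from has_integral_add[OF 1 has_integral_mult_right[OF this, of "\<xi> * p"]]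
  have "((\<lambda>t. \<bar>G t\<bar> powr p) has_integral (\<alpha> * \<bar>u\<bar> powr p + \<xi> * p * integral {0..\<alpha>} (\<lambda>t. H (G t)))) {0..\<alpha>}"
    by simp
  moreover have "integral {0..\<alpha>} (\<lambda>t. H (G t))
      = \<alpha> / \<xi> * exp (u / \<xi>) * (LINT s:{u<..}|lebesgue. H s * exp (- s / \<xi>))"
    using log_substitution[OF assms(1,2) Hi[unfolded G_def]] by (simp add: G_def)
  ultimately show ?thesis using assms(2)
    by (simp add: G_def H_def distrib_left mult_ac)
qed

lemma log_profile_has_integral_unit:
  fixes F :: "real \<Rightarrow> real"
  assumes "0 \<le> \<alpha>" "\<alpha> \<le> 1" "0 < \<alpha> \<Longrightarrow> ((\<lambda>t. F (u + \<xi> * ln (\<alpha> / t))) has_integral (\<alpha> * K)) {0..\<alpha>}"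
  shows "((\<lambda>t. F (log_profile \<xi> u \<alpha> t)) has_integral (\<alpha> * K + (1 - \<alpha>) * F u)) {0..1}"
proof -
  have "((\<lambda>t. F (u + \<xi> * ln (\<alpha> / t))) has_integral (\<alpha> * K)) {0..min 1 \<alpha>}"
    using assms by (cases "\<alpha> = 0") (auto simp: min_absorb2)
  from log_profile_has_integral[OF _ assms(1) this] show ?thesis
    using assms by (simp add: min_absorb2)
qed

text \<open>Here K is the mean of F over the logarithmic part, and the equation for \<alpha> * \<xi>
  prescribes the mean of the profile. The conditions on F are restricted to 0 < \<alpha> because the
  profile is constant when \<alpha> = 0.\<close>

lemma log_profile_optimizer:
  assumes C: "C > 0" and xi: "exp (- \<xi>) = C * (1 - \<xi>)" "\<xi> < 1"
    and \<alpha>: "0 \<le> \<alpha>" "\<alpha> \<le> 1" "\<alpha> * \<xi> = fst x - u" and x2: "snd x = tangent_line \<xi> (fst x) u"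
    and F: "0 < \<alpha> \<Longrightarrow> (\<lambda>t. F (u + \<xi> * ln (\<alpha> / t))) absolutely_integrable_on {0..\<alpha>}"
      "0 < \<alpha> \<Longrightarrow> ((\<lambda>t. F (u + \<xi> * ln (\<alpha> / t))) has_integral (\<alpha> * K)) {0..\<alpha>}"
      "G x = \<alpha> * K + (1 - \<alpha>) * F u"
  shows "is_optimizer F G C x (log_profile \<xi> u \<alpha>)"
proof (rule is_optimizerI[where N = "{}" and \<phi> = "log_profile \<xi> u \<alpha>"])
  have p1: "log_profile \<xi> u \<alpha> 1 = u" using \<alpha> by (simp add: log_profile_def)
  show "(log_profile \<xi> u \<alpha> has_integral fst x) {0..1}"
    using log_profile_integrals(1)[of 1 \<alpha> \<xi> u] \<alpha> by (simp add: p1 min_absorb2)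
  have "exp u * (1 + \<alpha> * \<xi> / (1 - \<xi>)) = snd x"
    unfolding x2 tangent_line_def \<alpha>(3) by (simp add: add.commute)
  then show "((\<lambda>t. exp (log_profile \<xi> u \<alpha> t)) has_integral snd x) {0..1}"
    using log_profile_integrals(2)[of 1 \<alpha> \<xi> u] \<alpha>(1,2) xi by (simp add: p1 min_absorb2)
  show "(\<lambda>t. F (log_profile \<xi> u \<alpha> t)) absolutely_integrable_on {0..1}"
    by (rule log_profile_absolutely_integrable[OF \<alpha>(1,2) F(1)])
  show "((\<lambda>t. F (log_profile \<xi> u \<alpha> t)) has_integral G x) {0..1}"
    unfolding F(3) by (rule log_profile_has_integral_unit[OF \<alpha>(1,2) F(2)])
  show "\<exists>a. integral {s..r} (\<lambda>t. tangent_gap C a (log_profile \<xi> u \<alpha> t)) \<le> 0"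
    if "0 \<le> s" "s < r" "r \<le> 1" for s r
    by (rule log_profile_gap[OF xi that(1,2) \<alpha>(1)])
qed (use C log_profile_id_integrable[OF \<alpha>(1,2)] in auto)

section \<open>Optimality of \<open>phi_plus\<close> and \<open>phi_minus\<close>\<close>

lemma phi_plus_eq:
  "phi_plus C x = log_profile (xi_plus C) (u_plus C x) ((fst x - u_plus C x) / xi_plus C)"
  by (simp add: fun_eq_iff phi_plus_def log_profile_def Let_def)

lemma phi_minus_eq:
  "phi_minus C x = log_profile (xi_minus C) (u_minus C x) ((fst x - u_minus C x) / xi_minus C)"
  by (simp add: fun_eq_iff phi_minus_def log_profile_def Let_def)

lemma alpha_plus:
  assumes "C > 1" "x \<in> Omega C"
  shows "0 \<le> (fst x - u_plus C x) / xi_plus C" "(fst x - u_plus C x) / xi_plus C \<le> 1"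
  using u_plus[OF assms] xi_plus[OF assms(1)] by (auto simp: divide_le_eq)

lemma phi_plus_optimizer_b:
  assumes C: "C > 1" and x: "x \<in> Omega C" and p: "1 < p" "p \<le> 2"
  shows "is_optimizer (\<lambda>t. \<bar>t\<bar> powr p) (b_cand p C) C x (phi_plus C x)"
proof -
  define \<xi> u \<alpha> where "\<xi> = xi_plus C" and "u = u_plus C x" and "\<alpha> = (fst x - u) / \<xi>"
  note xi = xi_plus[OF C, folded \<xi>_def]
  note u = u_plus[OF C x, folded \<xi>_def u_def]
  note a = alpha_plus[OF C x, folded \<xi>_def u_def, folded \<alpha>_def]
  have ax: "\<alpha> * \<xi> = fst x - u" using xi by (simp add: \<alpha>_def)
  define L where "L = (LINT s:{u<..}|lebesgue. \<bar>s\<bar> powr (p - 1) * sgn s * exp (- s / \<xi>))"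
  show ?thesis
    unfolding phi_plus_eq \<xi>_def[symmetric] u_def[symmetric] \<alpha>_def[symmetric]
  proof (rule log_profile_optimizer[OF _ xi(1,3) a ax u(1), where K = "\<bar>u\<bar> powr p + p * exp (u / \<xi>) * L"])
    assume a0: "0 < \<alpha>"
    show "((\<lambda>t. \<bar>u + \<xi> * ln (\<alpha> / t)\<bar> powr p) has_integral \<alpha> * (\<bar>u\<bar> powr p + p * exp (u / \<xi>) * L)) {0..\<alpha>}"
      unfolding L_def by (rule abs_powr_log_has_integral[OF a0 xi(2) p])
    then show "(\<lambda>t. \<bar>u + \<xi> * ln (\<alpha> / t)\<bar> powr p) absolutely_integrable_on {0..\<alpha>}"
      by (intro nonnegative_absolutely_integrable_1) auto
  next
    have "b_cand p C x = p / \<xi> * exp (u / \<xi>) * L * (\<alpha> * \<xi>) + \<bar>u\<bar> powr p"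
      by (simp add: b_cand_def Let_def ax L_def flip: \<xi>_def u_def)
    also have "\<dots> = \<alpha> * (\<bar>u\<bar> powr p + p * exp (u / \<xi>) * L) + (1 - \<alpha>) * \<bar>u\<bar> powr p"
      using xi by (simp add: algebra_simps)
    finally show "b_cand p C x = \<alpha> * (\<bar>u\<bar> powr p + p * exp (u / \<xi>) * L) + (1 - \<alpha>) * \<bar>u\<bar> powr p" .
  qed (use C in simp)
qed

lemma phi_plus_optimizer_A:
  assumes C: "C > 1" and x: "x \<in> Omega C" and d: "1 \<le> \<delta>" "\<delta> < 1 / xi_plus C"
  shows "is_optimizer (\<lambda>t. exp (\<delta> * t)) (A_cand \<delta> C) C x (phi_plus C x)"
proof -
  define \<xi> u \<alpha> where "\<xi> = xi_plus C" and "u = u_plus C x" and "\<alpha> = (fst x - u) / \<xi>"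
  note xi = xi_plus[OF C, folded \<xi>_def]
  note u = u_plus[OF C x, folded \<xi>_def u_def]
  note a = alpha_plus[OF C x, folded \<xi>_def u_def, folded \<alpha>_def]
  have ax: "\<alpha> * \<xi> = fst x - u" using xi by (simp add: \<alpha>_def)
  have d1: "\<delta> * \<xi> < 1" using d(2) xi by (simp add: \<xi>_def[symmetric] field_simps)
  show ?thesis
    unfolding phi_plus_eq \<xi>_def[symmetric] u_def[symmetric] \<alpha>_def[symmetric]
  proof (rule log_profile_optimizer[OF _ xi(1,3) a ax u(1), where K = "exp (\<delta> * u) / (1 - \<delta> * \<xi>)"])
    assume a0: "0 < \<alpha>"
    show "((\<lambda>t. exp (\<delta> * (u + \<xi> * ln (\<alpha> / t)))) has_integral \<alpha> * (exp (\<delta> * u) / (1 - \<delta> * \<xi>))) {0..\<alpha>}"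
      \<comment> \<open>The exponent of \<alpha> / t is now \<delta> * \<xi>; the bound \<delta> < 1
        / \<xi> is exactly integrability at 0.\<close>
      using exp_ln_has_integral[OF d1 a0 a0, of "\<delta> * u"] a0 by (simp add: distrib_left mult.assoc)
    then show "(\<lambda>t. exp (\<delta> * (u + \<xi> * ln (\<alpha> / t)))) absolutely_integrable_on {0..\<alpha>}"
      by (intro nonnegative_absolutely_integrable_1) auto
  next
    have "A_cand \<delta> C x = exp (\<delta> * u) * (\<delta> / (1 - \<delta> * \<xi>) * (\<alpha> * \<xi>) + 1)"
      by (simp add: A_cand_def Let_def ax flip: \<xi>_def u_def)
    also have "\<dots> = \<alpha> * (exp (\<delta> * u) / (1 - \<delta> * \<xi>)) + (1 - \<alpha>) * exp (\<delta> * u)"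
      using d1 by (simp add: field_simps)
    finally show "A_cand \<delta> C x = \<alpha> * (exp (\<delta> * u) / (1 - \<delta> * \<xi>)) + (1 - \<alpha>) * exp (\<delta> * u)" .
  qed (use C in simp)
qed

lemma phi_minus_optimizer_B2:
  assumes C: "C > 1" and x: "x \<in> Omega C"
  shows "is_optimizer (\<lambda>t. t\<^sup>2) (B2_cand C) C x (phi_minus C x)"
proof -
  define \<xi> u \<alpha> where "\<xi> = xi_minus C" and "u = u_minus C x" and "\<alpha> = (fst x - u) / \<xi>"
  note xi = xi_minus[OF C, folded \<xi>_def]
  note u = u_minus[OF C x, folded \<xi>_def u_def]
  have a: "0 \<le> \<alpha>" "\<alpha> \<le> 1" using u xi by (auto simp: \<alpha>_def divide_le_eq zero_le_divide_iff)
  have ax: "\<alpha> * \<xi> = fst x - u" using xi by (simp add: \<alpha>_def)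
  have "\<xi> < 1" using xi by simp
  show ?thesis
    unfolding phi_minus_eq \<xi>_def[symmetric] u_def[symmetric] \<alpha>_def[symmetric]
  proof (rule log_profile_optimizer[OF _ xi(1) \<open>\<xi> < 1\<close> a ax u(1), where K = "u\<^sup>2 + 2 * u * \<xi> + 2 * \<xi>\<^sup>2"])
    assume a0: "0 < \<alpha>"
    show "((\<lambda>t. (u + \<xi> * ln (\<alpha> / t))\<^sup>2) has_integral \<alpha> * (u\<^sup>2 + 2 * u * \<xi> + 2 * \<xi>\<^sup>2)) {0..\<alpha>}"
      using quadratic_log_has_integral[OF a0, of u \<xi>] by (simp add: algebra_simps)
    then show "(\<lambda>t. (u + \<xi> * ln (\<alpha> / t))\<^sup>2) absolutely_integrable_on {0..\<alpha>}"
      by (intro nonnegative_absolutely_integrable_1) auto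
  next
    have "B2_cand C x = u\<^sup>2 + 2 * u * (fst x - u) + 2 * \<xi> * (fst x - u)"
      by (simp add: B2_cand_def Let_def power2_eq_square algebra_simps flip: \<xi>_def u_def)
    also have "\<dots> = \<alpha> * (u\<^sup>2 + 2 * u * \<xi> + 2 * \<xi>\<^sup>2) + (1 - \<alpha>) * u\<^sup>2"
      unfolding ax[symmetric] by (simp add: power2_eq_square algebra_simps)
    finally show "B2_cand C x = \<alpha> * (u\<^sup>2 + 2 * u * \<xi> + 2 * \<xi>\<^sup>2) + (1 - \<alpha>) * u\<^sup>2" .
  qed (use C in simp)
qed

section \<open>Step functions\<close>

text \<open>Total on the reals with half-open pieces, so breakpoints need no separate values.
  Two-valued functions are the case p = q.\<close>

definition step3 :: "real \<Rightarrow> real \<Rightarrow> real \<Rightarrow> real \<Rightarrow> real \<Rightarrow> real \<Rightarrow> real" where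
  "step3 p q c1 c2 c3 t = (if t < p then c1 else if t < q then c2 else c3)"

lemma step3_has_integral:
  fixes F :: "real \<Rightarrow> real"
  assumes "s \<le> p" "p \<le> q" "q \<le> r"
  shows "((\<lambda>t. F (step3 p q c1 c2 c3 t)) has_integral ((p - s) * F c1 + (q - p) * F c2 + (r - q) * F c3)) {s..r}"
proof -
  let ?f = "\<lambda>t. F (step3 p q c1 c2 c3 t)"
  have piece: "(?f has_integral ((b - a) * F c)) {a..b}"
    if "a \<le> b" "\<And>t. t \<in> {a..b} - {a, b} \<Longrightarrow> ?f t = F c" for a b c
  proof -
    have "((\<lambda>t. F c) has_integral ((b - a) * F c)) {a..b}"
      using has_integral_const_real[of "F c" a b] that(1) by simp
    then show ?thesis by (rule has_integral_spike_finite[of "{a, b}", rotated 2]) (use that in auto)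
  qed
  have "(?f has_integral ((p - s) * F c1)) {s..p}"
    by (rule piece) (use assms in \<open>auto simp: step3_def\<close>)
  moreover have "(?f has_integral ((q - p) * F c2)) {p..q}"
    by (rule piece) (use assms in \<open>auto simp: step3_def\<close>)
  moreover have "(?f has_integral ((r - q) * F c3)) {q..r}"
    by (rule piece) (use assms in \<open>auto simp: step3_def\<close>)
  ultimately show ?thesis
    using assms by (intro has_integral_combine[of s q r] has_integral_combine[of s p q]) auto
qed

lemma step3_absolutely_integrable:
  fixes F :: "real \<Rightarrow> real"
  assumes "0 \<le> p" "p \<le> q" "q \<le> 1"
  shows "(\<lambda>t. F (step3 p q c1 c2 c3 t)) absolutely_integrable_on {0..1}"
  using step3_has_integral[OF assms, of F] step3_has_integral[OF assms, of "\<lambda>y. norm (F y)"]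
  by (intro absolutely_integrable_onI) blast+

lemma step3_integrable:
  fixes F :: "real \<Rightarrow> real"
  assumes "0 \<le> p" "p \<le> q" "q \<le> 1" "0 \<le> s" "r \<le> 1"
  shows "(\<lambda>t. F (step3 p q c1 c2 c3 t)) integrable_on {s..r}"
proof -
  have "(\<lambda>t. F (step3 p q c1 c2 c3 t)) integrable_on {0..1}"
    using step3_has_integral[OF assms(1-3), of F] by blast
  then show ?thesis by (rule integrable_on_subinterval) (use assms in auto)
qed

lemma step3_optimizer:
  assumes C: "C > 1" and pq: "0 \<le> p" "p \<le> q" "q \<le> 1"
    and N: "negligible N" "\<And>t. t \<in> {0..1} - N \<Longrightarrow> \<psi> t = step3 p q c1 c2 c3 t"
    and x1: "fst x = p * c1 + (q - p) * c2 + (1 - q) * c3"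
    and x2: "snd x = p * exp c1 + (q - p) * exp c2 + (1 - q) * exp c3"
    and G: "G x = p * f c1 + (q - p) * f c2 + (1 - q) * f c3"
    and gap: "\<And>s r. \<lbrakk>0 \<le> s; s < r; r \<le> 1\<rbrakk> \<Longrightarrow>
      \<exists>a. integral {s..r} (\<lambda>t. tangent_gap C a (step3 p q c1 c2 c3 t)) \<le> 0"
  shows "is_optimizer f G C x \<psi>"
proof (rule is_optimizerI[OF N])
  show "step3 p q c1 c2 c3 absolutely_integrable_on {0..1}"
    using step3_absolutely_integrable[OF pq, of "\<lambda>y. y" c1 c2 c3] by simp
  show "(step3 p q c1 c2 c3 has_integral fst x) {0..1}"
    using step3_has_integral[OF pq, of "\<lambda>y. y" c1 c2 c3] by (simp add: x1)
  show "((\<lambda>t. exp (step3 p q c1 c2 c3 t)) has_integral snd x) {0..1}"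
    using step3_has_integral[OF pq, of exp c1 c2 c3] by (simp add: x2)
  show "((\<lambda>t. f (step3 p q c1 c2 c3 t)) has_integral G x) {0..1}"
    using step3_has_integral[OF pq, of f c1 c2 c3] by (simp add: G)
qed (use C gap step3_absolutely_integrable[OF pq] in auto)

text \<open>The range is restricted only on the open interval, and c may depend on that interval; a
  function with three values still passes where one of its outer values does not occur.\<close>

lemma step3_narrow_gap:
  assumes C: "C > 1" and pq: "0 \<le> p" "p \<le> q" "q \<le> 1" and sr: "0 \<le> s" "r \<le> 1"
    and rng: "\<And>t. t \<in> {s<..<r} \<Longrightarrow> c \<le> step3 p q c1 c2 c3 t \<and> step3 p q c1 c2 c3 t \<le> c + xi_plus C - xi_minus C"
  shows "\<exists>a. integral {s..r} (\<lambda>t. tangent_gap C a (step3 p q c1 c2 c3 t)) \<le> 0"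
proof
  show "integral {s..r} (\<lambda>t. tangent_gap C (c + xi_plus C) (step3 p q c1 c2 c3 t)) \<le> 0"
    using step3_integrable[OF pq sr] rng
    by (rule gap_of_narrow_range[OF xi_plus(1)[OF C] xi_minus(1)[OF C]])
qed

text \<open>The zero z lies between the zero w and y, so a negative value at y would force a
  negative value at z by convexity.\<close>

lemma tangent_gap_nonneg_outside:
  assumes "tangent_gap C a w = 0" "tangent_gap C a z = 0" "w < z \<and> z \<le> y \<or> y \<le> z \<and> z < w"
  shows "0 \<le> tangent_gap C a y"
proof -
  define t where "t = (z - w) / (y - w)"
  have t: "0 < t" "t \<le> 1" using assms(3) by (auto simp: t_def field_simps)
  have "t * (y - w) = z - w" using assms(3) by (auto simp: t_def)
  then have z: "z = (1 - t) *\<^sub>R w + t *\<^sub>R y" by (simp add: algebra_simps)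
  have "tangent_gap C a z \<le> (1 - t) * tangent_gap C a w + t * tangent_gap C a y"
    unfolding z by (rule convex_onD[OF convex_on_tangent_gap]) (use t in auto)
  then show ?thesis using assms t by (simp add: zero_le_mult_iff)
qed

text \<open>The lines bounding \<open>Omega_plus\<close>, \<open>Omega_zero\<close> and
  \<open>Omega_minus\<close> are thereby recognized as the two tangents through (0, 1), that is,
  with contact u = 0.\<close>

lemma tangent_line_zero:
  assumes "exp (- \<xi>) = C * (1 - \<xi>)" "\<xi> < 1"
  shows "C * exp \<xi> * x1 + 1 = tangent_line \<xi> x1 0"
  using C_exp_xi[OF assms] by (simp add: tangent_line_def)

text \<open>Strict monotonicity in the contact point turns a comparison of \<open>u_plus\<close>
  with u0 into a comparison of the point with the tangent at u0. The tangent is consulted only for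
  u0 \<ge> fst x - \<open>xi_plus C\<close>, since below that bound the claim follows from the range
  of \<open>u_plus\<close>.\<close>

lemma u_plus_ge:
  assumes C: "C > 1" and x: "x \<in> Omega C" and "u0 \<le> fst x"
    and "fst x - xi_plus C \<le> u0 \<Longrightarrow> snd x \<le> tangent_line (xi_plus C) (fst x) u0"
  shows "u0 \<le> u_plus C x"
proof (rule ccontr)
  assume *: "\<not> u0 \<le> u_plus C x"
  then have "fst x - xi_plus C \<le> u0" using u_plus(2)[OF C x] by linarith
  moreover have "tangent_line (xi_plus C) (fst x) u0 < snd x"
    unfolding u_plus(1)[OF C x]
    by (rule tangent_line_strict_antimono) (use * u_plus[OF C x] xi_plus[OF C] in auto)
  ultimately show False using assms(4) by linarith
qed

lemma u_plus_le:
  assumes C: "C > 1" and x: "x \<in> Omega C" and "fst x - xi_plus C \<le> u0"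
    and "u0 \<le> fst x \<Longrightarrow> tangent_line (xi_plus C) (fst x) u0 \<le> snd x"
  shows "u_plus C x \<le> u0"
proof (rule ccontr)
  assume *: "\<not> u_plus C x \<le> u0"
  then have "u0 \<le> fst x" using u_plus(3)[OF C x] by linarith
  moreover have "snd x < tangent_line (xi_plus C) (fst x) u0"
    unfolding u_plus(1)[OF C x]
    by (rule tangent_line_strict_antimono) (use * assms(3) xi_plus[OF C] in auto)
  ultimately show False using assms(4) by linarith
qed

lemma u_minus_le:
  assumes C: "C > 1" and x: "x \<in> Omega C" and "fst x \<le> u0"
    and "u0 \<le> fst x - xi_minus C \<Longrightarrow> snd x \<le> tangent_line (xi_minus C) (fst x) u0"
  shows "u_minus C x \<le> u0"
proof (rule ccontr)
  assume *: "\<not> u_minus C x \<le> u0"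
  then have "u0 \<le> fst x - xi_minus C" using u_minus(3)[OF C x] by linarith
  moreover have "tangent_line (xi_minus C) (fst x) u0 < snd x"
    unfolding u_minus(1)[OF C x]
    by (rule tangent_line_strict_mono) (use * u_minus[OF C x] xi_minus[OF C] in auto)
  ultimately show False using assms(4) by linarith
qed

lemma u_minus_ge:
  assumes C: "C > 1" and x: "x \<in> Omega C" and "u0 \<le> fst x - xi_minus C"
    and "fst x \<le> u0 \<Longrightarrow> tangent_line (xi_minus C) (fst x) u0 \<le> snd x"
  shows "u0 \<le> u_minus C x"
proof (rule ccontr)
  assume *: "\<not> u0 \<le> u_minus C x"
  then have "fst x \<le> u0" using u_minus(2)[OF C x] by linarith
  moreover have "snd x < tangent_line (xi_minus C) (fst x) u0"
    unfolding u_minus(1)[OF C x]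
    by (rule tangent_line_strict_mono) (use * assms(3) xi_minus[OF C] in auto)
  ultimately show False using assms(4) by linarith
qed

lemma u_plus_nonneg:
  assumes C: "C > 1" and x: "x \<in> Omega C" "x \<in> Omega_plus C"
  shows "0 \<le> u_plus C x"
proof (rule u_plus_ge[OF C x(1)])
  note p = xi_plus[OF C]
  show "0 \<le> fst x" using x(2) p by (auto simp: Omega_plus_def)
  assume "fst x - xi_plus C \<le> 0"
  \<comment> \<open>The second piece of \<open>Omega_plus\<close> matters only at fst x =
    \<open>xi_plus C\<close>, where the line touches the upper boundary.\<close>
  moreover have "C * exp (xi_plus C) * xi_plus C + 1 = C * exp (xi_plus C)"
    using tangent_line_zero[OF p(1,3)] tangent_line_at_contact[OF p(1,3), of "xi_plus C"] by simp
  ultimately show "snd x \<le> tangent_line (xi_plus C) (fst x) 0"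
    using x(2) unfolding tangent_line_zero[OF p(1,3), symmetric] by (auto simp: Omega_plus_def)
qed

lemma u_minus_nonpos:
  assumes C: "C > 1" and x: "x \<in> Omega C" "x \<in> Omega_minus C"
  shows "u_minus C x \<le> 0"
proof (rule u_minus_le[OF C x(1)])
  note m = xi_minus[OF C]
  then have m1: "xi_minus C < 1" by simp
  show "fst x \<le> 0" using x(2) m by (auto simp: Omega_minus_def)
  assume "0 \<le> fst x - xi_minus C"
  moreover have "C * exp (xi_minus C) * xi_minus C + 1 = C * exp (xi_minus C)"
    using tangent_line_zero[OF m(1) m1] tangent_line_at_contact[OF m(1) m1, of "xi_minus C"] by simp
  ultimately show "snd x \<le> tangent_line (xi_minus C) (fst x) 0"
    using x(2) unfolding tangent_line_zero[OF m(1) m1, symmetric] by (auto simp: Omega_minus_def)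
qed

text \<open>\<open>psi\<close> tests \<open>Omega_minus\<close> before falling through to the
  formula for \<open>Omega_zero\<close>. On their common boundary, the tangent through (0, 1), this
  identity shows that both formulas describe the same function.\<close>

lemma u_minus_zero:
  assumes C: "C > 1" and x: "x \<in> Omega C" "x \<in> Omega_minus C" "x \<in> Omega_zero C"
  shows "u_minus C x = 0"
proof (rule antisym[OF u_minus_nonpos[OF C x(1,2)]], rule u_minus_ge[OF C x(1)])
  note m = xi_minus[OF C]
  then have m1: "xi_minus C < 1" by simp
  have "xi_minus C \<le> fst x" "fst x \<le> 0"
    using x(2,3) m by (auto simp: Omega_minus_def Omega_zero_def)
  then show "0 \<le> fst x - xi_minus C" by simp
  show "tangent_line (xi_minus C) (fst x) 0 \<le> snd x"
    using x(3) \<open>fst x \<le> 0\<close> unfolding tangent_line_zero[OF m(1) m1, symmetric]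
    by (auto simp: Omega_zero_def)
qed

section \<open>Optimality of \<open>psi\<close>, region by region\<close>

lemma Omega_cover:
  assumes C: "C > 1" and "x \<in> Omega C" "x \<notin> Omega_plus C" "x \<notin> Omega_minus C"
  shows "x \<in> Omega_zero C"
  using assms xi_plus[OF C] xi_minus[OF C]
  by (cases x) (auto simp: Omega_def Omega_zero_def Omega_plus_def Omega_minus_def)

text \<open>The tangent with contact u meets the lower boundary again at u + d. Since x lies on it,
  x is a convex combination of these two boundary points with weight \<beta>. The function f stays
  arbitrary so that the lemma serves both the absolute value and, after a shift, the
  indicator.\<close>

lemma psi_optimizer_plus:
  assumes C: "C > 1" and x: "x \<in> Omega C" "x \<in> Omega_plus C"
    and \<beta>: "\<beta> = (fst x - u_plus C x) / (xi_plus C - xi_minus C)"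
    and G: "G x = \<beta> * f (u_plus C x + (xi_plus C - xi_minus C)) + (1 - \<beta>) * f (u_plus C x)"
  shows "is_optimizer f G C x (psi C x)"
proof -
  note p = xi_plus[OF C] and m = xi_minus[OF C]
  define u d where "u = u_plus C x" and "d = xi_plus C - xi_minus C"
  note u = u_plus[OF C x(1), folded u_def]
  have d: "0 < d" "xi_plus C < d" using p m by (auto simp: d_def)
  have b: "0 \<le> \<beta>" "\<beta> \<le> 1" "\<beta> * d = fst x - u"
    using u d unfolding \<beta> by (auto simp: u_def[symmetric] d_def[symmetric])
  have "exp (u + d) = exp u * ((1 - xi_minus C) / (1 - xi_plus C))"
    unfolding exp_add d_def exp_xi_diff(1)[OF C] ..
  moreover have "(1 - xi_minus C) / (1 - xi_plus C) = d / (1 - xi_plus C) + 1"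
    using p by (simp add: d_def field_simps)
  ultimately have ed: "exp (u + d) = exp u * (d / (1 - xi_plus C) + 1)" by simp
  show ?thesis
  proof (rule step3_optimizer[OF C, where p = \<beta> and q = \<beta> and ?c1.0 = "u + d" and ?c2.0 = u and ?c3.0 = u and N = "{0}"])
    show "psi C x t = step3 \<beta> \<beta> (u + d) u u t" if "t \<in> {0..1} - {0}" for t
      using that x(2) \<beta> by (simp add: psi_def Let_def step3_def indicator_def u_def d_def)
    show "fst x = \<beta> * (u + d) + (\<beta> - \<beta>) * u + (1 - \<beta>) * u" using b by (simp add: algebra_simps)
    have "\<beta> * exp (u + d) + (\<beta> - \<beta>) * exp u + (1 - \<beta>) * exp u = exp u * (\<beta> * d / (1 - xi_plus C) + 1)"
      unfolding ed by (simp add: algebra_simps)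
    then show "snd x = \<beta> * exp (u + d) + (\<beta> - \<beta>) * exp u + (1 - \<beta>) * exp u"
      unfolding b u(1) tangent_line_def by simp
    show "G x = \<beta> * f (u + d) + (\<beta> - \<beta>) * f u + (1 - \<beta>) * f u"
      using G by (simp add: u_def d_def)
    show "\<exists>a. integral {s..r} (\<lambda>t. tangent_gap C a (step3 \<beta> \<beta> (u + d) u u t)) \<le> 0"
      if "0 \<le> s" "s < r" "r \<le> 1" for s r
      by (rule step3_narrow_gap[where c = u]) (use C b that d in \<open>auto simp: step3_def d_def\<close>)
  qed (use b in auto)
qed

lemma psi_optimizer_minus:
  assumes C: "C > 1" and x: "x \<in> Omega C" "x \<in> Omega_minus C" "x \<notin> Omega_plus C"
    and \<beta>: "\<beta> = (u_minus C x - fst x) / (xi_plus C - xi_minus C)"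
    and G: "G x = \<beta> * f (u_minus C x - (xi_plus C - xi_minus C)) + (1 - \<beta>) * f (u_minus C x)"
  shows "is_optimizer f G C x (psi C x)"
proof -
  note p = xi_plus[OF C] and m = xi_minus[OF C]
  define u d where "u = u_minus C x" and "d = xi_plus C - xi_minus C"
  note u = u_minus[OF C x(1), folded u_def]
  have d: "0 < d" "- xi_minus C < d" using p m by (auto simp: d_def)
  have b: "0 \<le> \<beta>" "\<beta> \<le> 1" "\<beta> * d = u - fst x"
    using u d unfolding \<beta> by (auto simp: u_def[symmetric] d_def[symmetric])
  have "exp (u - d) = exp u * ((1 - xi_plus C) / (1 - xi_minus C))"
    using exp_add[of u "xi_minus C - xi_plus C"] unfolding exp_xi_diff(2)[OF C]
    by (simp add: d_def diff_diff_eq2 add_diff_eq)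
  moreover have "(1 - xi_plus C) / (1 - xi_minus C) = 1 - d / (1 - xi_minus C)"
    using m by (simp add: d_def field_simps)
  ultimately have ed: "exp (u - d) = exp u * (1 - d / (1 - xi_minus C))" by simp
  show ?thesis
  proof (rule step3_optimizer[OF C, where p = "1 - \<beta>" and q = "1 - \<beta>" and ?c1.0 = u and ?c2.0 = u and ?c3.0 = "u - d" and N = "{1 - \<beta>, 1}"])
    show "psi C x t = step3 (1 - \<beta>) (1 - \<beta>) u u (u - d) t" if "t \<in> {0..1} - {1 - \<beta>, 1}" for t
      using that x(2,3) \<beta> by (auto simp: psi_def Let_def step3_def indicator_def u_def d_def)
    show "fst x = (1 - \<beta>) * u + (1 - \<beta> - (1 - \<beta>)) * u + (1 - (1 - \<beta>)) * (u - d)" using b by (simp add: algebra_simps)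
    have "(1 - \<beta>) * exp u + (1 - \<beta> - (1 - \<beta>)) * exp u + (1 - (1 - \<beta>)) * exp (u - d) = exp u * (1 - \<beta> * d / (1 - xi_minus C))"
      unfolding ed by (simp add: algebra_simps)
    also have "\<dots> = exp u * ((fst x - u) / (1 - xi_minus C) + 1)"
      unfolding b by (simp add: diff_divide_distrib)
    finally show "snd x = (1 - \<beta>) * exp u + (1 - \<beta> - (1 - \<beta>)) * exp u + (1 - (1 - \<beta>)) * exp (u - d)"
      unfolding u(1) tangent_line_def by simp
    show "G x = (1 - \<beta>) * f u + (1 - \<beta> - (1 - \<beta>)) * f u + (1 - (1 - \<beta>)) * f (u - d)"
      using G by (simp add: u_def d_def)
    show "\<exists>a. integral {s..r} (\<lambda>t. tangent_gap C a (step3 (1 - \<beta>) (1 - \<beta>) u u (u - d) t)) \<le> 0"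
      if "0 \<le> s" "s < r" "r \<le> 1" for s r
      by (rule step3_narrow_gap[where c = "u - d"]) (use C b that d in \<open>auto simp: step3_def d_def\<close>)
  qed (use b in auto)
qed

text \<open>The weights solve the two equations for the averages of a function with values d, 0, -d;
  \<open>gx1\<close> and \<open>gX\<close> are these equations, using exp d - 1 = d / P and 1 - exp
  (- d) = d / M. They are nonnegative because x lies above both tangents through (0, 1), and their
  sum is at most 1 because x lies below the upper boundary.\<close>

lemma psi_optimizer_zero:
  assumes C: "C > 1" and x: "x \<in> Omega C" "x \<in> Omega_zero C" "x \<notin> Omega_plus C"
    and gp: "\<gamma>p = ((snd x - 1) * (1 - xi_minus C) * (1 - xi_plus C) - fst x * (1 - xi_plus C)) / (xi_plus C - xi_minus C)\<^sup>2"
    and gm: "\<gamma>m = ((snd x - 1) * (1 - xi_minus C) * (1 - xi_plus C) - fst x * (1 - xi_minus C)) / (xi_plus C - xi_minus C)\<^sup>2"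
    and G: "G x = \<gamma>p * f (xi_plus C - xi_minus C) + (1 - \<gamma>p - \<gamma>m) * f 0 + \<gamma>m * f (- (xi_plus C - xi_minus C))"
  shows "is_optimizer f G C x (psi C x)"
proof -
  note p = xi_plus[OF C] and m = xi_minus[OF C]
  define d P M x1 X where "d = xi_plus C - xi_minus C" and "P = 1 - xi_plus C" and "M = 1 - xi_minus C"
    and "x1 = fst x" and "X = snd x - 1"
  have m1: "xi_minus C < 1" using m by simp
  have PM: "0 < P" "0 < M" "P \<le> M" "0 < d" "M = P + d" using p m by (auto simp: d_def P_def M_def)
  have gp': "\<gamma>p = (X * M * P - x1 * P) / d\<^sup>2" and gm': "\<gamma>m = (X * M * P - x1 * M) / d\<^sup>2"
    unfolding gp gm d_def P_def M_def x1_def X_def by simp_all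
  have line: "C * exp (xi_plus C) * x1 + 1 = x1 / P + 1" "C * exp (xi_minus C) * x1 + 1 = x1 / M + 1"
    using C_exp_xi[OF p(1,3)] C_exp_xi[OF m(1) m1] by (auto simp: P_def M_def)
  have rng: "xi_minus C \<le> x1" "x1 \<le> xi_plus C" using x(2) p m by (auto simp: Omega_zero_def x1_def)
  have XC: "X + 1 \<le> C * exp x1" using x(1) by (auto simp: Omega_def x1_def X_def)
  have low: "x1 \<le> 0 \<and> x1 / M \<le> X \<or> 0 \<le> x1 \<and> x1 / P \<le> X"
    using x(2) line by (auto simp: Omega_zero_def x1_def X_def)
  have XM: "x1 \<le> X * M" and XP: "x1 \<le> X * P"
  proof -
    \<comment> \<open>Membership gives only the tangent belonging to the sign of x1; on that side it
      is the higher of the two.\<close>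
    have *: "x1 / M \<le> X" "x1 / P \<le> X"
    proof -
      have "0 \<le> x1 \<Longrightarrow> x1 / M \<le> x1 / P" using PM by (intro divide_left_mono) auto
      moreover have "x1 \<le> 0 \<Longrightarrow> x1 / P \<le> x1 / M" using PM by (intro divide_left_mono_neg) auto
      ultimately show "x1 / M \<le> X" "x1 / P \<le> X" using low by auto
    qed
    then show "x1 \<le> X * M" "x1 \<le> X * P" using PM by (auto simp: divide_le_eq)
  qed
  have g0: "0 \<le> \<gamma>p" "0 \<le> \<gamma>m"
  proof -
    have "0 \<le> (X * M - x1) * P" "0 \<le> (X * P - x1) * M" using XM XP PM by auto
    then show "0 \<le> \<gamma>p" "0 \<le> \<gamma>m" unfolding gp' gm' by (auto simp: algebra_simps)
  qed
  \<comment> \<open>The convex upper boundary is replaced by its chord over the interval from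
    \<open>xi_minus C\<close> to \<open>xi_plus C\<close>. The bound becomes affine in the chord
    parameter \<theta>, with end values - \<open>xi_minus C\<close> * d and \<open>xi_plus C\<close>
    * d, both at most the square of d.\<close>
  have g1: "\<gamma>p + \<gamma>m \<le> 1"
  proof -
    define \<theta> where "\<theta> = (x1 - xi_minus C) / d"
    have th: "0 \<le> \<theta>" "\<theta> \<le> 1" "\<theta> * d = x1 - xi_minus C"
      using rng PM by (auto simp: \<theta>_def d_def)
    have x1t: "x1 = (1 - \<theta>) * xi_minus C + \<theta> * xi_plus C"
      using th(3) by (simp add: d_def algebra_simps)
    have "exp x1 \<le> (1 - \<theta>) * exp (xi_minus C) + \<theta> * exp (xi_plus C)"
      unfolding x1t using convex_onD[OF exp_convex, of \<theta> "xi_minus C" "xi_plus C"] th by simp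
    then have "C * exp x1 \<le> C * ((1 - \<theta>) * exp (xi_minus C) + \<theta> * exp (xi_plus C))"
      using C by (intro mult_left_mono) auto
    also have "\<dots> = (1 - \<theta>) * (C * exp (xi_minus C)) + \<theta> * (C * exp (xi_plus C))"
      by (simp add: algebra_simps)
    also have "\<dots> = (1 - \<theta>) / M + \<theta> / P"
      using C_exp_xi[OF p(1,3)] C_exp_xi[OF m(1) m1] by (simp add: P_def M_def)
    finally have "X + 1 \<le> (1 - \<theta>) / M + \<theta> / P" using XC by linarith
    then have "(X + 1) * (M * P) \<le> ((1 - \<theta>) / M + \<theta> / P) * (M * P)"
      using PM by (intro mult_right_mono) auto
    also have "\<dots> = (1 - \<theta>) * P + \<theta> * M" using PM(1,2) by (simp add: field_simps)
    finally have XMP: "X * (M * P) \<le> (1 - \<theta>) * P + \<theta> * M - M * P" by (simp add: algebra_simps)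
    have "X * M * P - x1 * P + (X * M * P - x1 * M) = 2 * (X * (M * P)) - x1 * (P + M)"
      by (simp add: algebra_simps)
    also have "\<dots> \<le> 2 * ((1 - \<theta>) * P + \<theta> * M - M * P) - x1 * (P + M)"
      using XMP by (intro diff_right_mono mult_left_mono) auto
    also have "\<dots> = \<theta> * (xi_plus C * d) + (1 - \<theta>) * (- xi_minus C * d)"
      unfolding x1t P_def M_def d_def by (simp add: algebra_simps)
    also have "\<dots> \<le> \<theta> * (d * d) + (1 - \<theta>) * (d * d)"
      using th p m PM(4) by (intro add_mono mult_left_mono mult_right_mono) (auto simp: d_def)
    also have "\<dots> = d\<^sup>2" by (simp add: power2_eq_square algebra_simps)
    finally show ?thesis unfolding gp' gm' add_divide_distrib[symmetric] using PM(4) by (simp add: divide_le_eq)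
  qed
  have gx1: "(\<gamma>p - \<gamma>m) * d = x1"
  proof -
    have "\<gamma>p - \<gamma>m = (x1 * d) / d\<^sup>2"
      unfolding gp' gm' diff_divide_distrib[symmetric] PM(5) by (simp add: algebra_simps)
    then show ?thesis using PM(4) by (simp add: power2_eq_square)
  qed
  have gX: "\<gamma>p * (d / P) - \<gamma>m * (d / M) = X"
  proof -
    have "\<gamma>p * (d / P) = (X * M - x1) / d" "\<gamma>m * (d / M) = (X * P - x1) / d"
      unfolding gp' gm' using PM(1,2,4) by (simp_all add: field_simps power2_eq_square)
    then have "\<gamma>p * (d / P) - \<gamma>m * (d / M) = X * (M - P) / d"
      by (simp add: diff_divide_distrib[symmetric] algebra_simps)
    then show ?thesis using PM by simp
  qed
  show ?thesis
  proof (cases "x \<in> Omega_minus C")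
    case True
    have u0: "u_minus C x = 0" by (rule u_minus_zero[OF C x(1) True x(2)])
    then have "X = x1 / M"
      using u_minus(1)[OF C x(1)] by (simp add: tangent_line_def X_def x1_def M_def)
    then have "\<gamma>p = 0" unfolding gp' using PM by simp
    then have b: "\<gamma>m = - x1 / d" using gx1 PM(4) by (simp add: field_simps)
    show ?thesis
    proof (rule psi_optimizer_minus[OF C x(1) True x(3)])
      show "\<gamma>m = (u_minus C x - fst x) / (xi_plus C - xi_minus C)"
        unfolding b u0 by (simp add: x1_def d_def)
      show "G x = \<gamma>m * f (u_minus C x - (xi_plus C - xi_minus C)) + (1 - \<gamma>m) * f (u_minus C x)"
        unfolding u0 G \<open>\<gamma>p = 0\<close> by simp
    qed
  next
    case False
    have ed: "exp d = d / P + 1" "exp (- d) = 1 - d / M"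
      using exp_xi_diff[OF C] PM(1,2) by (auto simp: d_def P_def M_def field_simps)
    let ?S = "step3 \<gamma>p (1 - \<gamma>m) d 0 (- d)"
    have ex: "snd x = \<gamma>p * exp d + (1 - \<gamma>m - \<gamma>p) * exp 0 + (1 - (1 - \<gamma>m)) * exp (- d)"
      unfolding ed using gX by (simp add: X_def algebra_simps)
    have ef: "fst x = \<gamma>p * d + (1 - \<gamma>m - \<gamma>p) * 0 + (1 - (1 - \<gamma>m)) * (- d)"
      using gx1 by (simp add: x1_def algebra_simps)
    show ?thesis
    proof (rule step3_optimizer[OF C _ _ _ _ _ ef ex, where N = "{0, 1 - \<gamma>m, 1}"])
      show "psi C x t = ?S t" if "t \<in> {0..1} - {0, 1 - \<gamma>m, 1}" for t
      proof -
        have "psi C x t = d * (indicat_real {0<..<\<gamma>p} t - indicat_real {1 - \<gamma>m<..<1} t)"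
          using x(3) False by (simp add: psi_def Let_def gp gm d_def)
        then show ?thesis using that g1 by (auto simp: step3_def indicator_def)
      qed
      show "G x = \<gamma>p * f d + (1 - \<gamma>m - \<gamma>p) * f 0 + (1 - (1 - \<gamma>m)) * f (- d)"
        unfolding G by (simp add: d_def algebra_simps)
      show "\<exists>a. integral {s..r} (\<lambda>t. tangent_gap C a (?S t)) \<le> 0"
        if sr: "0 \<le> s" "s < r" "r \<le> 1" for s r
      proof -
        \<comment> \<open>In the first two cases the value d, respectively -d, is missing on (s, r),
          and the remaining spread is at most d.\<close>
        consider "\<gamma>p \<le> s" | "r \<le> 1 - \<gamma>m" | "s < \<gamma>p" "1 - \<gamma>m < r" by linarith
        then show ?thesis
        proof cases
          case 1
          show ?thesis
            by (rule step3_narrow_gap[where c = "- d"])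
               (use C g0 g1 sr 1 PM in \<open>auto simp: step3_def d_def\<close>)
        next
          case 2
          show ?thesis
            by (rule step3_narrow_gap[where c = 0])
               (use C g0 g1 sr 2 PM in \<open>auto simp: step3_def d_def\<close>)
        next
          case 3
          \<comment> \<open>At the tangency point \<open>x1\<close> the gap is nonnegative at \<open>d\<close> and \<open>- d\<close>, so the
            integral over \<open>{s..r}\<close> is at most the one over \<open>{0..1}\<close>, which is \<open>snd x - C * exp x1\<close>.\<close>
          let ?g = "tangent_gap C x1"
          have gd: "0 \<le> ?g d" "0 \<le> ?g (- d)"
          proof -
            have z: "?g (x1 - xi_plus C) = 0" "?g (x1 - xi_minus C) = 0"
              using tangent_gap_contact[OF p(1), of "x1 - xi_plus C"]
                tangent_gap_contact[OF m(1), of "x1 - xi_minus C"] by auto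
            show "0 \<le> ?g d"
              by (rule tangent_gap_nonneg_outside[OF z]) (use rng p m in \<open>auto simp: d_def\<close>)
            show "0 \<le> ?g (- d)"
              by (rule tangent_gap_nonneg_outside[OF z(2,1)]) (use rng p m in \<open>auto simp: d_def\<close>)
          qed
          have "((\<lambda>t. ?g (?S t)) has_integral
              ((\<gamma>p - s) * ?g d + (1 - \<gamma>m - \<gamma>p) * ?g 0 + (r - (1 - \<gamma>m)) * ?g (- d))) {s..r}"
            by (rule step3_has_integral) (use 3 g1 in auto)
          then have "integral {s..r} (\<lambda>t. ?g (?S t))
              = (\<gamma>p - s) * ?g d + (1 - \<gamma>m - \<gamma>p) * ?g 0 + (r - (1 - \<gamma>m)) * ?g (- d)"
            by (rule integral_unique)
          also have "\<dots> \<le> \<gamma>p * ?g d + (1 - \<gamma>m - \<gamma>p) * ?g 0 + (1 - (1 - \<gamma>m)) * ?g (- d)"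
            using gd sr by (intro add_mono order_refl mult_right_mono) auto
          also have "\<dots> = (\<gamma>p * exp d + (1 - \<gamma>m - \<gamma>p) * exp 0 + (1 - (1 - \<gamma>m)) * exp (- d))
              - C * exp x1 * (1 - x1 + (\<gamma>p * d + (1 - \<gamma>m - \<gamma>p) * 0 + (1 - (1 - \<gamma>m)) * (- d)))"
            unfolding tangent_gap_def by (simp add: algebra_simps)
          also have "\<dots> = snd x - C * exp x1"
            unfolding ef[symmetric] ex[symmetric] by (simp add: x1_def)
          also have "\<dots> \<le> 0" using XC by (simp add: X_def)
          finally show ?thesis by blast
        qed
      qed
    qed (use g0 g1 in auto)
  qed
qed

text \<open>On \<open>Omega_plus\<close> all values are nonnegative because \<open>u_plus\<close>
  is, on \<open>Omega_minus\<close> all are nonpositive; there the absolute value integrates to plus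
  or minus the mean. On \<open>Omega_zero\<close> the integral is d times the sum of the two
  weights.\<close>

lemma psi_optimizer_b1:
  assumes C: "C > 1" and x: "x \<in> Omega C"
  shows "is_optimizer (\<lambda>t. \<bar>t\<bar>) (b1_cand C) C x (psi C x)"
proof -
  note p = xi_plus[OF C] and m = xi_minus[OF C]
  define d where "d = xi_plus C - xi_minus C"
  have d: "0 < d" using p m by (simp add: d_def)
  consider "x \<in> Omega_plus C" | "x \<in> Omega_minus C" "x \<notin> Omega_plus C"
    | "x \<in> Omega_zero C" "x \<notin> Omega_minus C" "x \<notin> Omega_plus C"
    using Omega_cover[OF C x] by blast
  then show ?thesis
  proof cases
    case 1
    have u: "0 \<le> u_plus C x" by (rule u_plus_nonneg[OF C x 1])
    \<comment> \<open>\<open>b1_cand\<close> tests \<open>Omega_minus\<close> first; the two regions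
      can meet only at fst x = 0, where both branches agree.\<close>
    have "b1_cand C x = fst x"
      using 1 p m by (auto simp: b1_cand_def Let_def Omega_minus_def Omega_plus_def)
    then show ?thesis
      using u d by (intro psi_optimizer_plus[OF C x 1 refl]) (simp add: d_def[symmetric] field_simps)
  next
    case 2
    have u: "u_minus C x \<le> 0" by (rule u_minus_nonpos[OF C x 2(1)])
    have "b1_cand C x = - fst x"
      using 2 by (simp add: b1_cand_def Let_def)
    then show ?thesis
      using u d by (intro psi_optimizer_minus[OF C x 2 refl]) (simp add: d_def[symmetric] field_simps)
  next
    case 3
    define P M x1 X where "P = 1 - xi_plus C" and "M = 1 - xi_minus C"
      and "x1 = fst x" and "X = snd x - 1"
    have "b1_cand C x = 2 * (M * P / d) * X + (xi_plus C + xi_minus C - 2) / d * x1"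
      using 3 by (simp add: b1_cand_def Let_def d_def P_def M_def x1_def X_def)
    also have "xi_plus C + xi_minus C - 2 = - (P + M)" by (simp add: P_def M_def)
    also have "2 * (M * P / d) * X + - (P + M) / d * x1
        = (X * M * P - x1 * P) / d\<^sup>2 * d + (X * M * P - x1 * M) / d\<^sup>2 * d"
    proof -
      have *: "y / d\<^sup>2 * d = y / d" for y using d by (simp add: power2_eq_square)
      show ?thesis unfolding * by (simp add: algebra_simps add_divide_distrib diff_divide_distrib)
    qed
    finally show ?thesis
      using d by (intro psi_optimizer_zero[OF C x 3(1,3) refl refl])
        (simp add: d_def[symmetric] P_def[symmetric] M_def[symmetric] x1_def[symmetric] X_def[symmetric])
  qed
qed

section \<open>The functions \<open>\<eta>\<close>\<close>

lemma avg_add_const: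
  assumes "\<psi> absolutely_integrable_on Q" "is_interval J" "J \<subseteq> Q" "measure lebesgue J > 0"
  shows "avg J (\<lambda>t. c + \<psi> t) = c + avg J \<psi>"
proof -
  have J: "J \<in> lmeasurable"
    using assms(2,3) by (intro measurable_convex is_interval_convex) (auto intro: bounded_subset[of Q])
  have "set_integrable lebesgue J \<psi>"
    by (rule set_integrable_subset[OF assms(1)]) (use J assms in auto)
  moreover have "set_integrable lebesgue J (\<lambda>t. c)"
    using J by (simp add: set_integrable_def lmeasurable_iff_integrable)
  ultimately have "(LINT t:J|lebesgue. c + \<psi> t) = (LINT t:J|lebesgue. c) + (LINT t:J|lebesgue. \<psi> t)"
    by (intro set_integral_add)
  also have "(LINT t:J|lebesgue. c) = measure lebesgue J * c"
    using J by (simp add: set_lebesgue_integral_def fmeasurable_def)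
  finally show ?thesis using assms(4) by (simp add: avg_def add_divide_distrib)
qed

lemma avg_exp_add_const: "avg J (\<lambda>t. exp (c + \<psi> t)) = exp c * avg J (\<lambda>t. exp (\<psi> t))"
  by (simp add: avg_def exp_add)

text \<open>Adding a constant multiplies each mean of the exponential by \<open>exp lam\<close> and
  each exponential of the negative mean by its inverse, so the characteristic does not change. The
  two candidates need to be related only at the given point.\<close>

lemma is_optimizer_shift:
  assumes opt: "is_optimizer (\<lambda>y. f (lam + y)) G C (y1, y2) \<psi>"
    and G': "G' (y1 + lam, y2 * exp lam) = G (y1, y2)"
  shows "is_optimizer f G' C (y1 + lam, y2 * exp lam) (\<lambda>t. lam + \<psi> t)"
proof -
  from opt have i: "\<psi> absolutely_integrable_on Q" "(\<lambda>t. exp (\<psi> t)) absolutely_integrable_on Q"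
    and a: "avg Q \<psi> = y1" "avg Q (\<lambda>t. exp (\<psi> t)) = y2"
    and A: "A_infty_char Q (\<lambda>t. exp (\<psi> t)) \<le> ereal C"
    and f: "(\<lambda>t. f (lam + \<psi> t)) absolutely_integrable_on Q" "avg Q (\<lambda>t. f (lam + \<psi> t)) = G (y1, y2)"
    by (auto simp: is_optimizer_def E_class_def)
  have "(\<lambda>t. lam) absolutely_integrable_on Q"
    by (simp add: set_integrable_def)
  then have "(\<lambda>t. lam + \<psi> t) absolutely_integrable_on Q"
    using i(1) by (rule set_integral_add)
  moreover have "(\<lambda>t. exp (lam + \<psi> t)) absolutely_integrable_on Q"
    unfolding exp_add using i(2) by (rule set_integrable_mult_right)
  moreover have "avg Q (\<lambda>t. lam + \<psi> t) = y1 + lam"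
    using avg_add_const[OF i(1), of Q lam] a by simp
  moreover have "A_infty_char Q (\<lambda>t. exp (lam + \<psi> t)) = A_infty_char Q (\<lambda>t. exp (\<psi> t))"
    unfolding A_infty_char_def
  proof (rule SUP_cong[OF refl])
    fix J assume "J \<in> {J. is_interval J \<and> J \<subseteq> Q \<and> measure lebesgue J > 0}"
    then have "avg J (\<lambda>t. lam + \<psi> t) = lam + avg J \<psi>" by (intro avg_add_const[OF i(1)]) auto
    then show "ereal (avg J (\<lambda>t. exp (lam + \<psi> t)) * exp (- avg J (\<lambda>t. ln (exp (lam + \<psi> t)))))
      = ereal (avg J (\<lambda>t. exp (\<psi> t)) * exp (- avg J (\<lambda>t. ln (exp (\<psi> t)))))"
      unfolding avg_exp_add_const ln_exp
      by (simp add: exp_diff exp_minus divide_inverse)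
  qed
  ultimately show ?thesis
    using a A f G' by (simp add: is_optimizer_def E_class_def avg_exp_add_const)
qed

lemma Omega_shift: "(y1 + lam, y2 * exp lam) \<in> Omega C \<longleftrightarrow> (y1, y2) \<in> Omega C"
  by (simp add: Omega_def exp_add flip: mult.assoc)

lemma Omega4_shift: "(y1 + lam, y2 * exp lam) \<in> Omega4 C lam \<longleftrightarrow> (y1, y2) \<in> Omega_plus C"
proof -
  have "y2 * exp lam \<le> exp lam * (k + 1) \<longleftrightarrow> y2 \<le> k + 1" for k :: real
    by (simp add: mult.commute[of "exp lam"])
  then show ?thesis
    by (auto simp: Omega4_def Omega_plus_def exp_add simp flip: mult.assoc)
qed

lemma Omega3_shift: "(y1 + lam, y2 * exp lam) \<in> Omega3 C lam \<longleftrightarrow> (y1, y2) \<in> Omega_zero C"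
proof -
  have "exp lam * (k + 1) \<le> y2 * exp lam \<longleftrightarrow> k + 1 \<le> y2" for k :: real
    by (simp add: mult.commute[of "exp lam"])
  then show ?thesis
    by (auto simp: Omega3_def Omega_zero_def exp_add simp flip: mult.assoc)
qed

text \<open>The shift by lam carries \<open>Omega4\<close> and \<open>Omega3\<close> to
  \<open>Omega_plus\<close> and \<open>Omega_zero\<close>, and the indicator becomes that of
  nonnegative values. On \<open>Omega4\<close> all values qualify; on \<open>Omega3\<close> only the
  value -d fails.\<close>

lemma eta_optimizer_Omega34:
  assumes C: "C > 1" and x: "x \<in> Omega C" "x \<in> Omega3 C lam \<union> Omega4 C lam"
  shows "is_optimizer (indicat_real {lam..}) (D_cand lam C) C x (eta lam C x)"
proof -
  define y1 y2 where "y1 = fst x - lam" and "y2 = snd x * exp (- lam)"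
  have xy: "x = (y1 + lam, y2 * exp lam)"
    by (simp add: y1_def y2_def exp_minus prod_eq_iff)
  have y: "(y1, y2) \<in> Omega C" using x(1) unfolding xy Omega_shift .
  have d: "0 < xi_plus C - xi_minus C" using xi_plus[OF C] xi_minus[OF C] by simp
  have eta: "eta lam C x = (\<lambda>t. lam + psi C (y1, y2) t)"
    using x(2) by (simp add: fun_eq_iff eta_def Let_def y1_def y2_def)
  define G where "G = (\<lambda>y. D_cand lam C (fst y + lam, snd y * exp lam))"
  have "is_optimizer (\<lambda>y. indicat_real {lam..} (lam + y)) G C (y1, y2) (psi C (y1, y2))"
  proof (cases "(y1, y2) \<in> Omega_plus C")
    case True
    have "0 \<le> u_plus C (y1, y2)" by (rule u_plus_nonneg[OF C y True])
    moreover have "G (y1, y2) = 1"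
      using True by (simp add: G_def D_cand_def Let_def Omega4_shift)
    ultimately show ?thesis
      using d by (intro psi_optimizer_plus[OF C y True refl]) (simp add: indicator_def)
  next
    case False
    then have z: "(y1, y2) \<in> Omega_zero C" using x(2) by (auto simp: xy Omega3_shift Omega4_shift)
    have "G (y1, y2) = (1 - xi_minus C) / (xi_plus C - xi_minus C)\<^sup>2 * (y1 + (1 - y2) * (1 - xi_plus C)) + 1"
      using False z by (simp add: G_def D_cand_def Let_def Omega4_shift Omega3_shift exp_minus)
    \<comment> \<open>The candidate is 1 minus the weight of the value -d.\<close>
    also have "\<dots> = 1 - ((y2 - 1) * (1 - xi_minus C) * (1 - xi_plus C) - y1 * (1 - xi_minus C)) / (xi_plus C - xi_minus C)\<^sup>2"
    proof -
      have *: "M / D * (y1 + (1 - y2) * P) + 1 = 1 - ((y2 - 1) * M * P - y1 * M) / D" for M P D :: real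
        by (cases "D = 0") (simp_all add: field_simps)
      show ?thesis by (rule *)
    qed
    finally show ?thesis
      using d by (intro psi_optimizer_zero[OF C y z False refl refl]) (simp add: indicator_def)
  qed
  then show ?thesis
    unfolding eta unfolding xy by (rule is_optimizer_shift) (simp add: G_def)
qed

text \<open>The upper edge of \<open>Omega2\<close> lies on the tangent chord of the lower boundary
  over lam - d and lam. Below it the second intersection v satisfies v \<ge> lam - d, so the jump of
  \<open>eta\<close> is at most d and the narrow-range criterion applies.\<close>

lemma eta_optimizer_Omega2:
  assumes C: "C > 1" and x: "x \<in> Omega2 C lam" "x \<notin> Omega3 C lam" "x \<notin> Omega4 C lam"
  shows "is_optimizer (indicat_real {lam..}) (D_cand lam C) C x (eta lam C x)"
proof -
  note p = xi_plus[OF C] and m = xi_minus[OF C]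
  define d M where "d = xi_plus C - xi_minus C" and "M = 1 - xi_minus C"
  obtain x1 x2 where xx: "x = (x1, x2)" by force
  define v where "v = v_coord lam x"
  have CM: "C * exp (xi_minus C) = 1 / M" using C_exp_xi[OF m(1)] m by (simp add: M_def)
  have M: "M > 0" and d: "d > 0" using m p by (auto simp: M_def d_def)
  have x1: "lam - d \<le> x1" "x1 < lam" "exp x1 \<le> x2" and x2: "x2 \<le> exp lam * (1 / M * (x1 - lam) + 1)"
    using x(1) unfolding CM[symmetric] by (auto simp: Omega2_def xx d_def)
  have e: "exp (lam - d) = exp lam * (1 - d / M)"
  proof -
    have "exp (lam - d) = exp lam * exp (xi_minus C - xi_plus C)"
      by (simp add: d_def diff_diff_eq2 add_diff_eq flip: exp_add)
    also have "exp (xi_minus C - xi_plus C) = 1 - d / M"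
      unfolding exp_xi_diff(2)[OF C] using M by (simp add: d_def M_def field_simps)
    finally show ?thesis .
  qed
  have "(lam - x1) * (exp lam - exp (lam - d)) \<le> (exp lam - x2) * (lam - (lam - d))"
  proof -
    have "exp lam * ((lam - x1) / M) \<le> exp lam - x2"
      using x2 by (simp add: algebra_simps diff_divide_distrib)
    then have "exp lam * ((lam - x1) / M) * d \<le> (exp lam - x2) * d"
      using d by (intro mult_right_mono) auto
    then show ?thesis unfolding e by (simp add: algebra_simps)
  qed
  note v = v_coord[OF x1 this, folded xx, folded v_def]
  define \<mu> where "\<mu> = (x1 - v) / (lam - v)"
  have \<mu>: "0 \<le> \<mu>" "\<mu> \<le> 1" "\<mu> * (lam - v) = x1 - v"
    using v x1 by (auto simp: \<mu>_def divide_le_eq)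
  have ex: "x2 = \<mu> * exp lam + (1 - \<mu>) * exp v"
  proof -
    have "(lam - v) * (exp lam - x2) = (lam - v) * ((1 - \<mu>) * (exp lam - exp v))"
    proof -
      have "(lam - v) * (1 - \<mu>) = lam - x1" using \<mu>(3) by (simp add: algebra_simps)
      then show ?thesis using v(4) by (metis mult.assoc mult.commute)
    qed
    then have "exp lam - x2 = (1 - \<mu>) * (exp lam - exp v)" using v(3) by simp
    then show ?thesis by (simp add: algebra_simps)
  qed
  show ?thesis
  proof (rule step3_optimizer[OF C, where p = \<mu> and q = \<mu> and ?c1.0 = lam and ?c2.0 = v and ?c3.0 = v and N = "{0, \<mu>, 1}"])
    show "eta lam C x t = step3 \<mu> \<mu> lam v v t" if "t \<in> {0..1} - {0, \<mu>, 1}" for t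
    proof -
      have "eta lam C x t = lam * indicat_real {0<..<\<mu>} t + v * indicat_real {\<mu><..<1} t"
        using x by (simp add: eta_def Let_def xx flip: v_def[unfolded xx])
          (simp add: \<mu>_def)
      then show ?thesis using that by (auto simp: step3_def indicator_def)
    qed
    show "fst x = \<mu> * lam + (\<mu> - \<mu>) * v + (1 - \<mu>) * v" using \<mu>(3) by (simp add: xx algebra_simps)
    show "snd x = \<mu> * exp lam + (\<mu> - \<mu>) * exp v + (1 - \<mu>) * exp v" using ex by (simp add: xx)
    have "D_cand lam C x = \<mu>"
      using x by (simp add: D_cand_def Let_def v_def[symmetric] \<mu>_def) (simp add: xx)
    then show "D_cand lam C x = \<mu> * indicat_real {lam..} lam + (\<mu> - \<mu>) * indicat_real {lam..} v
        + (1 - \<mu>) * indicat_real {lam..} v"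
      using v(3) by simp
    show "\<exists>a. integral {s..r} (\<lambda>t. tangent_gap C a (step3 \<mu> \<mu> lam v v t)) \<le> 0"
      if "0 \<le> s" "s < r" "r \<le> 1" for s r
      by (rule step3_narrow_gap[where c = v]) (use C \<mu> that v(1,3) in \<open>auto simp: step3_def d_def\<close>)
  qed (use \<mu> in auto)
qed

text \<open>The line separating \<open>Omega1\<close> from \<open>Omega2\<close> has contact points
  lam - d and lam, so it is also the \<xi>-plus tangent with contact lam - d. Points above it have a
  smaller contact point. Exclusion from \<open>Omega3\<close> keeps x to the left of the tangency
  point \<open>lam + xi_minus C\<close>.\<close>

lemma u_plus_le_Omega1:
  assumes C: "C > 1" and x: "x \<in> Omega C" "x \<notin> Omega2 C lam" "x \<notin> Omega3 C lam" "x \<notin> Omega4 C lam"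
  shows "u_plus C x \<le> lam - (xi_plus C - xi_minus C)"
proof (rule u_plus_le[OF C x(1)])
  note p = xi_plus[OF C] and m = xi_minus[OF C]
  obtain x1 x2 where xx: "x = (x1, x2)" by force
  have x1: "x1 < lam" using x p unfolding xx by (auto simp: Omega_def Omega3_def Omega4_def)
  have line: "exp lam * (C * exp (xi_minus C) * (x1 - lam) + 1) < x2" if "lam + xi_minus C - xi_plus C \<le> x1"
    using x that x1 unfolding xx by (auto simp: Omega_def Omega2_def)
  have "x1 < lam + xi_minus C"
  proof (rule ccontr)
    assume "\<not> x1 < lam + xi_minus C"
    then show False using line x(1,3) x1 p unfolding xx by (simp add: Omega_def Omega3_def)
  qed
  then show "fst x - xi_plus C \<le> lam - (xi_plus C - xi_minus C)" by (simp add: xx)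
  assume "lam - (xi_plus C - xi_minus C) \<le> fst x"
  then have l: "exp lam * (C * exp (xi_minus C) * (x1 - lam) + 1) < x2" by (intro line) (simp add: xx)
  have CM: "C * exp (xi_minus C) = 1 / (1 - xi_minus C)" using C_exp_xi[OF m(1)] m by simp
  have "tangent_line (xi_plus C) x1 (lam - (xi_plus C - xi_minus C))
    = exp lam * exp (xi_minus C - xi_plus C) * ((x1 - lam + (xi_plus C - xi_minus C)) / (1 - xi_plus C) + 1)"
    unfolding tangent_line_def by (simp add: algebra_simps flip: exp_add)
  also have "\<dots> = exp lam * (C * exp (xi_minus C) * (x1 - lam) + 1)"
  proof -
    have "P / M * ((y + (M - P)) / P + 1) = 1 / M * y + 1" if "P > 0" "M > 0" for P M y :: real
      using that by (simp add: field_simps)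
    from this[of "1 - xi_plus C" "1 - xi_minus C" "x1 - lam"]
    have eq: "(1 - xi_plus C) / (1 - xi_minus C) * ((x1 - lam + (xi_plus C - xi_minus C)) / (1 - xi_plus C) + 1)
        = 1 / (1 - xi_minus C) * (x1 - lam) + 1"
      using p m by simp
    show ?thesis unfolding exp_xi_diff(2)[OF C] CM mult.assoc[of "exp lam"] eq ..
  qed
  finally show "tangent_line (xi_plus C) (fst x) (lam - (xi_plus C - xi_minus C)) \<le> snd x"
    using l by (simp add: xx)
qed


text \<open>The factor \<tau> is chosen so that \<open>phi_plus\<close> reaches lam - d at \<kappa>
  = \<tau> * \<alpha>. The logarithm on (0, \<kappa>) has its averages on the tangent with contact
  lam - d, which meets the lower boundary again at lam. They are therefore reproduced by the values
  lam and lam - d with relative weight \<xi> / d for lam, which is the relation \<rho> * d =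
  \<kappa> * \<xi>.\<close>

lemma eta_optimizer_Omega1:
  assumes C: "C > 1" and x: "x \<in> Omega C" "x \<notin> Omega2 C lam" "x \<notin> Omega3 C lam" "x \<notin> Omega4 C lam"
  shows "is_optimizer (indicat_real {lam..}) (D_cand lam C) C x (eta lam C x)"
proof -
  define \<xi> d u where "\<xi> = xi_plus C" and "d = xi_plus C - xi_minus C" and "u = u_plus C x"
  define \<alpha> \<beta> \<tau> where "\<alpha> = (fst x - u) / \<xi>" and "\<beta> = (fst x - u) / d" and "\<tau> = exp ((u + d - lam) / \<xi>)"
  define \<kappa> \<rho> where "\<kappa> = \<tau> * \<alpha>" and "\<rho> = \<tau> * \<beta>"
  note p = xi_plus[OF C, folded \<xi>_def] and m = xi_minus[OF C]
  note u = u_plus[OF C x(1), folded \<xi>_def u_def]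
  note a = alpha_plus[OF C x(1), folded \<xi>_def u_def, folded \<alpha>_def]
  have ud: "u + d \<le> lam" using u_plus_le_Omega1[OF C x] by (simp add: u_def d_def)
  have d: "0 < d" "\<xi> < d" using p m by (auto simp: d_def \<xi>_def)
  have t: "0 < \<tau>" "\<tau> \<le> 1" using ud p by (auto simp: \<tau>_def divide_le_0_iff)
  have bd: "\<beta> * d = \<alpha> * \<xi>" using p d by (simp add: \<alpha>_def \<beta>_def)
  have b: "0 \<le> \<beta>" "\<beta> \<le> \<alpha>" using u d p by (auto simp: \<alpha>_def \<beta>_def intro: divide_left_mono)
  have k: "0 \<le> \<rho>" "\<rho> \<le> \<kappa>" "0 \<le> \<kappa>" "\<kappa> \<le> \<alpha>" "\<kappa> \<le> 1" "\<rho> * d = \<kappa> * \<xi>"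
  proof -
    show "\<kappa> \<le> \<alpha>" using t a by (simp add: \<kappa>_def mult_left_le_one_le)
    then show "\<kappa> \<le> 1" using a by simp
  qed (use t a b bd in \<open>auto simp: \<kappa>_def \<rho>_def mult.assoc\<close>)
  define pr where "pr = log_profile \<xi> u \<alpha>"
  have prk: "pr \<kappa> = lam - d" if "0 < \<kappa>"
  proof -
    have a0: "0 < \<alpha>" using that k by simp
    have "pr \<kappa> = u + \<xi> * ln (\<alpha> / \<kappa>)"
      unfolding pr_def log_profile_eq_min[OF that a0] using k by (simp add: min_absorb1)
    also have "\<alpha> / \<kappa> = exp (- ((u + d - lam) / \<xi>))"
      using a0 by (simp add: \<kappa>_def \<tau>_def exp_minus field_simps)
    finally show ?thesis using p by simp
  qed
  have pr_le: "pr t \<le> lam - d" if "\<kappa> \<le> t" "0 \<le> t" for t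
  proof (cases "0 < \<kappa>")
    case True
    then show ?thesis using log_profile_antimono[of \<xi> \<kappa> t u \<alpha>] that p prk by (simp add: pr_def)
  next
    case False
    then have "\<alpha> = 0" using k t by (simp add: \<kappa>_def zero_less_mult_iff)
    then show ?thesis using ud by (simp add: pr_def log_profile_def)
  qed
  define S where "S = step3 \<rho> \<kappa> lam (lam - d) (lam - d)"
  define \<eta> where "\<eta> = (\<lambda>t. if t < \<kappa> then S t else pr t)"
  \<comment> \<open>On \<open>{0..\<kappa>}\<close> the step function has the same integral and the same exponential integral as
    the logarithm it replaces, so \<open>\<eta>\<close> inherits the averages and the gap integrals of \<open>pr\<close>.\<close>
  have replace: "((\<lambda>t. F (\<eta> t)) has_integral I) {0..r}"
    if r: "\<kappa> \<le> r" and I: "((\<lambda>t. F (pr t)) has_integral I) {0..r}"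
      and K: "((\<lambda>t. F (pr t)) has_integral (\<rho> * F lam + (\<kappa> - \<rho>) * F (lam - d))) {0..\<kappa>}"
    for F :: "real \<Rightarrow> real" and r I
  proof -
    let ?K = "\<rho> * F lam + (\<kappa> - \<rho>) * F (lam - d)"
    have "(\<lambda>t. F (pr t)) integrable_on {\<kappa>..r}"
      by (rule integrable_on_subinterval[OF has_integral_integrable[OF I]]) (use k in auto)
    moreover have "integral {0..\<kappa>} (\<lambda>t. F (pr t)) + integral {\<kappa>..r} (\<lambda>t. F (pr t)) = integral {0..r} (\<lambda>t. F (pr t))"
      using I k r by (intro Henstock_Kurzweil_Integration.integral_combine) auto
    ultimately have "((\<lambda>t. F (pr t)) has_integral (I - ?K)) {\<kappa>..r}"
      using integral_unique[OF I] integral_unique[OF K] by (simp add: has_integral_iff)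
    then have 1: "((\<lambda>t. F (\<eta> t)) has_integral (I - ?K)) {\<kappa>..r}"
      by (rule has_integral_eq[rotated]) (simp add: \<eta>_def)
    have "((\<lambda>t. F (S t)) has_integral ((\<rho> - 0) * F lam + (\<kappa> - \<rho>) * F (lam - d) + (\<kappa> - \<kappa>) * F (lam - d))) {0..\<kappa>}"
      unfolding S_def by (rule step3_has_integral) (use k in auto)
    then have "((\<lambda>t. F (S t)) has_integral ?K) {0..\<kappa>}" by simp
    then have "((\<lambda>t. F (\<eta> t)) has_integral ?K) {0..\<kappa>}"
      by (rule has_integral_spike_finite[of "{\<kappa>}", rotated 2]) (auto simp: \<eta>_def)
    from has_integral_combine[OF k(3) r this 1] show ?thesis by simp
  qed
  have ed: "exp lam = exp (lam - d) * (1 + d / (1 - \<xi>))"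
  proof -
    have "exp lam = exp (lam - d) * exp d" by (simp flip: exp_add)
    also have "exp d = 1 + d / (1 - \<xi>)"
      unfolding d_def exp_xi_diff(1)[OF C] using p by (simp add: \<xi>_def field_simps)
    finally show ?thesis .
  qed
  have id_eta: "(\<eta> has_integral I) {0..r}" if "\<kappa> \<le> r" "(pr has_integral I) {0..r}" for r I
  proof -
    have "(pr has_integral (\<rho> * lam + (\<kappa> - \<rho>) * (lam - d))) {0..\<kappa>}"
    proof (cases "0 < \<kappa>")
      case True
      have "(pr has_integral (\<kappa> * \<xi> + \<kappa> * (lam - d))) {0..\<kappa>}"
        using log_profile_integrals(1)[OF True a(1), of \<xi> u] k prk[OF True] by (simp add: pr_def min_absorb1)
      then show ?thesis using k(6) by (simp add: algebra_simps)
    next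
      case False
      then have "\<kappa> = 0" "\<rho> = 0" using k by auto
      then show ?thesis by (simp add: has_integral_refl)
    qed
    then show ?thesis using replace[of r "\<lambda>y. y"] that by simp
  qed
  have exp_eta: "((\<lambda>t. exp (\<eta> t)) has_integral I) {0..r}"
    if "\<kappa> \<le> r" "((\<lambda>t. exp (pr t)) has_integral I) {0..r}" for r I
  proof -
    have "((\<lambda>t. exp (pr t)) has_integral (\<rho> * exp lam + (\<kappa> - \<rho>) * exp (lam - d))) {0..\<kappa>}"
    proof (cases "0 < \<kappa>")
      case True
      have "((\<lambda>t. exp (pr t)) has_integral (exp (lam - d) * (\<kappa> + \<kappa> * \<xi> / (1 - \<xi>)))) {0..\<kappa>}"
        using log_profile_integrals(2)[OF True a(1) p(3), of u] k prk[OF True] by (simp add: pr_def min_absorb1)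
      moreover have "exp (lam - d) * (\<kappa> + \<kappa> * \<xi> / (1 - \<xi>)) = \<rho> * exp lam + (\<kappa> - \<rho>) * exp (lam - d)"
        unfolding ed k(6)[symmetric] by (simp add: algebra_simps)
      ultimately show ?thesis by (simp only:)
    next
      case False
      then have "\<kappa> = 0" "\<rho> = 0" using k by auto
      then show ?thesis by (simp add: has_integral_refl)
    qed
    then show ?thesis using replace[of r exp] that by simp
  qed
  have pr1: "pr 1 = u" using a by (simp add: pr_def log_profile_def)
  have eta1: "(\<eta> has_integral fst x) {0..1}"
  proof (rule id_eta[OF k(5)])
    show "(pr has_integral fst x) {0..1}"
      using log_profile_integrals(1)[of 1 \<alpha> \<xi> u] a p pr1 unfolding pr_def[symmetric]
      by (simp add: min_absorb2) (simp add: \<alpha>_def)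
  qed
  have eta2: "((\<lambda>t. exp (\<eta> t)) has_integral snd x) {0..1}"
  proof (rule exp_eta[OF k(5)])
    have "exp u * (1 + \<alpha> * \<xi> / (1 - \<xi>)) = snd x"
      unfolding u(1) tangent_line_def using p by (simp add: \<alpha>_def)
    then show "((\<lambda>t. exp (pr t)) has_integral snd x) {0..1}"
      using log_profile_integrals(2)[of 1 \<alpha> \<xi> u] a p pr1 unfolding pr_def[symmetric]
      by (simp add: min_absorb2)
  qed
  have anti: "\<eta> t' \<le> \<eta> t" if "0 < t" "t \<le> t'" for t t'
  proof (cases "t < \<kappa>")
    case True
    have "\<eta> t' \<le> S t"
    proof (cases "t' < \<kappa>")
      case True
      then show ?thesis using that d by (simp add: \<eta>_def S_def step3_def)
    next
      case False
      then have "\<eta> t' \<le> lam - d" using pr_le[of t'] that by (simp add: \<eta>_def)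
      then show ?thesis using d by (simp add: S_def step3_def)
    qed
    then show ?thesis using True by (simp add: \<eta>_def)
  next
    case False
    then show ?thesis using that p log_profile_antimono[of \<xi> t t' u \<alpha>] by (simp add: \<eta>_def pr_def)
  qed
  \<comment> \<open>Beyond \<rho> all values are at most lam - d, so the candidate is just the
    length \<rho> of the top step.\<close>
  have ind: "indicat_real {lam..} (\<eta> t) = step3 \<rho> \<rho> 1 0 0 t" if "t \<in> {0..1}" for t
    using that pr_le[of t] d k by (auto simp: \<eta>_def S_def step3_def indicator_def)
  show ?thesis
  proof (rule is_optimizerI[where N = "{0, \<rho>, \<kappa>, 1}" and \<phi> = \<eta>])
    show "eta lam C x t = \<eta> t" if "t \<in> {0..1} - {0, \<rho>, \<kappa>, 1}" for t
    proof -
      have "eta lam C x t = lam * indicat_real {0<..<\<rho>} t + (lam + xi_minus C - \<xi>) * indicat_real {\<rho><..<\<kappa>} t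
          + pr t * indicat_real {\<kappa><..<1} t"
        using x by (simp add: eta_def Let_def \<rho>_def \<kappa>_def \<tau>_def \<alpha>_def \<beta>_def u_def \<xi>_def d_def pr_def phi_plus_eq algebra_simps)
      then show ?thesis
        using that k by (auto simp: \<eta>_def S_def step3_def indicator_def d_def \<xi>_def)
    qed
    show "\<eta> absolutely_integrable_on {0..1}"
    proof (rule absolutely_integrable_on_combine[where c = \<kappa>])
      have "S absolutely_integrable_on {0..1}"
        using step3_absolutely_integrable[of \<rho> \<kappa> "\<lambda>y. y"] k unfolding S_def by simp
      then have "S absolutely_integrable_on {0..\<kappa>}"
        by (rule set_integrable_subset) (use k in auto)
      then show "\<eta> absolutely_integrable_on {0..\<kappa>}"
        by (rule absolutely_integrable_spike[of _ _ "{\<kappa>}"]) (auto simp: \<eta>_def)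
      have "pr absolutely_integrable_on {0..1}"
        unfolding pr_def by (rule log_profile_id_integrable[OF a])
      then have "pr absolutely_integrable_on {\<kappa>..1}"
        by (rule set_integrable_subset) (use k in auto)
      then show "\<eta> absolutely_integrable_on {\<kappa>..1}"
        by (rule absolutely_integrable_spike[of _ _ "{}"]) (auto simp: \<eta>_def)
    qed (use k in auto)
    have "((\<lambda>t. step3 \<rho> \<rho> 1 0 0 t) has_integral \<rho>) {0..1}"
      using step3_has_integral[of 0 \<rho> \<rho> 1 "\<lambda>y. y" 1 0 0] k by simp
    moreover have "D_cand lam C x = \<rho>"
      using x by (simp add: D_cand_def Let_def \<rho>_def \<tau>_def \<beta>_def u_def \<xi>_def d_def algebra_simps)
    ultimately show 1: "((\<lambda>t. indicat_real {lam..} (\<eta> t)) has_integral D_cand lam C x) {0..1}"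
      using ind by (subst has_integral_cong) auto
    then show "(\<lambda>t. indicat_real {lam..} (\<eta> t)) absolutely_integrable_on {0..1}"
      by (intro nonnegative_absolutely_integrable_1) auto
    show "\<exists>a. integral {s..r} (\<lambda>t. tangent_gap C a (\<eta> t)) \<le> 0"
      if sr: "0 \<le> s" "s < r" "r \<le> 1" for s r
    \<comment> \<open>Up to \<kappa> only the two steps occur, at distance d. Past \<kappa> the
      right endpoint lies in the logarithmic part, and the tail criterion applies.\<close>
    proof (cases "r \<le> \<kappa>")
      case True
      have "(\<lambda>t. tangent_gap C (lam - d + \<xi>) (\<eta> t)) integrable_on {0..1}"
        using tangent_gap_has_integral[OF eta1 eta2] by auto
      then have "(\<lambda>t. tangent_gap C (lam - d + \<xi>) (\<eta> t)) integrable_on {s..r}"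
        by (rule integrable_on_subinterval) (use sr in auto)
      then have "integral {s..r} (\<lambda>t. tangent_gap C (lam - d + \<xi>) (\<eta> t)) \<le> 0"
        by (rule gap_of_narrow_range[OF p(1) m(1)])
           (use True sr d in \<open>auto simp: \<eta>_def S_def step3_def d_def \<xi>_def\<close>)
      then show ?thesis by blast
    next
      case False
      then have r: "\<kappa> \<le> r" "0 < r" using k by auto
      let ?g = "\<lambda>y. tangent_gap C (pr r + \<xi>) y"
      note I = log_profile_integrals(1)[OF r(2) a(1), of \<xi> u, folded pr_def]
        and K = log_profile_integrals(2)[OF r(2) a(1) p(3), of u, folded pr_def]
      have "((\<lambda>t. ?g (pr t)) has_integral 0) {0..r}"
        unfolding pr_def by (rule log_profile_gap_integral_zero[OF p(1,3) r(2) a(1)])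
      \<comment> \<open>The vanishing integral passes from \<open>pr\<close> to \<eta> by equality
        of the two integrals over {0..r}; this is why \<open>id_eta\<close> and
        \<open>exp_eta\<close> are stated for every r \<ge> \<kappa>.\<close>
      with tangent_gap_has_integral[OF I K, of C "pr r + \<xi>"] r
      have "((\<lambda>t. ?g (\<eta> t)) has_integral 0) {0..r}"
        using tangent_gap_has_integral[OF id_eta[OF r(1) I] exp_eta[OF r(1) K], of C "pr r + \<xi>"]
        by (metis has_integral_unique less_imp_le)
      moreover have "?g (\<eta> r) \<le> 0"
        using False tangent_gap_contact[OF p(1), of "pr r"] by (simp add: \<eta>_def)
      moreover have "antimono_on {0<..r} \<eta>" using anti by (auto simp: monotone_on_def)
      ultimately show ?thesis using gap_of_tail[OF sr(1,2), of C "pr r + \<xi>" \<eta>] by blast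
    qed
  qed (use C eta1 eta2 in auto)
qed

theorem lemma5p2:
  fixes C :: real and x :: "real \<times> real"
  assumes "C > 1" and "x \<in> Omega C"
  shows
    "(\<forall>p. 1 < p \<and> p \<le> 2 \<longrightarrow>
        is_optimizer (\<lambda>t. \<bar>t\<bar> powr p) (b_cand p C) C x (phi_plus C x)) \<and>
     (\<forall>\<delta>. 1 \<le> \<delta> \<and> \<delta> < 1 / xi_plus C \<longrightarrow>
        is_optimizer (\<lambda>t. exp (\<delta> * t)) (A_cand \<delta> C) C x (phi_plus C x)) \<and>
     is_optimizer (\<lambda>t. t\<^sup>2) (B2_cand C) C x (phi_minus C x) \<and>
     is_optimizer (\<lambda>t. \<bar>t\<bar>) (b1_cand C) C x (psi C x) \<and>
     (\<forall>lam. is_optimizer (indicat_real {lam..}) (D_cand lam C) C x (eta lam C x))"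
proof (intro conjI allI impI)
  \<comment> \<open>Exhaustive without a covering argument, since the last region enters only
    through exclusion from the other three.\<close>
  show "is_optimizer (indicat_real {lam..}) (D_cand lam C) C x (eta lam C x)" for lam
    using eta_optimizer_Omega1[OF assms, of lam] eta_optimizer_Omega2[OF assms(1), of x lam]
      eta_optimizer_Omega34[OF assms, of lam] by blast
qed (use assms phi_plus_optimizer_b phi_plus_optimizer_A phi_minus_optimizer_B2 psi_optimizer_b1 in auto)

end
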